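(* Let $F\in\mathcal{E}^m$, let $A_1,\dots,A_d$ be an orthonormal basis of a linear subspace $\mathcal{L}\subseteq\mathbb{S}^m$, and let $L(\theta)=\sum_{i=1}^d\theta_iA_i$. Let $X_1,X_2,\dots$ be an i.i.d. sequence from a mean zero distribution on $\mathbb{R}^m$ with finite fourth order moments and positive definite covariance matrix $\Sigma_0=\nabla F^*(L(\theta_0))$, where $\theta_0\in\Theta_+$. Suppose that the function $M(\theta)=F^*(L(\theta))-\mathrm{tr}(L(\theta)\Sigma_0)$ is twice differentiable on $\Theta_+$ with positive definite Hessian $\mathcal{I}(\theta)=\nabla^2M(\theta)\in\mathbb{S}^d_+$, and put $\mathcal{I}_0=\mathcal{I}(\theta_0)$. Let $\widehat\theta_n$ be the Bregman estimator based on $S_n$. Then, as $n\to\infty$, $$\sqrt{n}\,(\widehat\theta_n-\theta_0)\;\overset{d}{\longrightarrow}\;N_d\big(0,\;\mathcal{I}_0^{-1}\,\Omega\,\mathcal{I}_0^{-1}\big),$$ where $\Omega\in\mathbb{S}^d$ has entries $$\Omega_{ij}=\mathcal{S}[A_i,A_j]:=\mathbb{E}\big(\langle X_1X_1^\top-\Sigma_0,A_i\rangle\,\langle X_1X_1^\top-\Sigma_0,A_j\rangle\big),\qquad i,j=1,\dots,d.$$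
   Context: $\mathbb{S}^m$ is the space of real symmetric $m\times m$ matrices with inner product $\langle A,B\rangle=\mathrm{tr}(AB)$ and Frobenius norm; $\mathbb{S}^m_+$ and $\overline{\mathbb{S}}^m_+$ are the subsets of positive definite and positive semidefinite matrices. $\mathcal{E}^m$ is the set of functions $F:\mathbb{S}^m\to\mathbb{R}\cup\{+\infty\}$ such that (i) $F$ is convex, not identically $+\infty$, and lower semicontinuous; (ii) $\mathbb{S}^m_+\subseteq\mathrm{dom}(F)\subseteq\overline{\mathbb{S}}^m_+$, where $\mathrm{dom}(F)=\{F<+\infty\}$; (iii) $F$ is strictly convex and continuously differentiable on $\mathbb{S}^m_+$. Gradients are with respect to $\langle\cdot,\cdot\rangle$. $\mathbb{L}^m_+:=\nabla F(\mathbb{S}^m_+)$. The conjugate is $F^*(L)=\sup_{\Sigma\in\mathbb{S}^m}\{\langle\Sigma,L\rangle-F(\Sigma)\}$; $\nabla F:\mathbb{S}^m_+\to\mathbb{L}^m_+$ and $\nabla F^*:\mathbb{L}^m_+\to\mathbb{S}^m_+$ are inverse to each other. $\Theta_+=\{\theta\in\mathbb{R}^d:L(\theta)\in\mathbb{L}^m_+\}$. The sample covariance matrix is $S_n=\frac1n\sum_{i=1}^nX_iX_i^\top$. The Bregman estimator $\widehat\theta_n$ is the (unique, if it exists) minimizer over $\theta\in\Theta_+$ of $M_n(\theta)=F^*(L(\theta))-\langle L(\theta),S_n\rangle$; on the event that no minimizer exists, $\widehat\theta_n$ is assigned an arbitrary value. The functions $M_n$ and $M$ differ by a function linear in $\theta$,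 so they have the same Hessian. *)

theory Defs
  imports "HOL-Probability.Probability"
begin

definition sym_mats :: "(real^'m^'m) set" where
  "sym_mats = {A. transpose A = A}"

definition pd_mats :: "(real^'m^'m) set" where
  "pd_mats = {A \<in> sym_mats. \<forall>x. x \<noteq> 0 \<longrightarrow> 0 < x \<bullet> (A *v x)}"

definition psd_mats :: "(real^'m^'m) set" where
  "psd_mats = {A \<in> sym_mats. \<forall>x. 0 \<le> x \<bullet> (A *v x)}"

text \<open>On \<^const>\<open>sym_mats\<close> this coincides with the library inner product \<open>(\<bullet>)\<close>, so the library
  norm on \<open>real^'m^'m\<close> is the Frobenius norm.\<close>

definition tr_inner :: "real^'m^'m \<Rightarrow> real^'m^'m \<Rightarrow> real" where
  "tr_inner A B = trace (A ** B)"

definition outer_sq :: "real^'m \<Rightarrow> real^'m^'m" where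
  "outer_sq x = (\<chi> i j. x $ i * x $ j)"

definition orthonormal_basis_of :: "('d \<Rightarrow> real^'m^'m) \<Rightarrow> (real^'m^'m) set \<Rightarrow> bool" where
  "orthonormal_basis_of A V \<longleftrightarrow>
     (\<forall>i j. tr_inner (A i) (A j) = (if i = j then 1 else 0)) \<and> span (range A) = V"

text \<open>Functions on the space of symmetric matrices are represented by functions on all square
  matrices whose values outside \<^const>\<open>sym_mats\<close> are never inspected.  Accordingly derivatives,
  limits and suprema are taken within \<^const>\<open>sym_mats\<close>.\<close>

text \<open>Only meaningful where \<open>f\<close> is finite near \<open>A\<close> (relative to \<^const>\<open>sym_mats\<close>).\<close>

definition has_grad_sym :: "(real^'m^'m \<Rightarrow> ereal) \<Rightarrow> real^'m^'m \<Rightarrow> real^'m^'m \<Rightarrow> bool" where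
  "has_grad_sym f G A \<longleftrightarrow> G \<in> sym_mats \<and>
     ((\<lambda>X. real_of_ereal (f X)) has_derivative (\<lambda>H. tr_inner G H)) (at A within sym_mats)"

definition grad_sym :: "(real^'m^'m \<Rightarrow> ereal) \<Rightarrow> real^'m^'m \<Rightarrow> real^'m^'m" where
  "grad_sym f A = (THE G. has_grad_sym f G A)"

lemma has_grad_sym_unique:
  fixes f :: "real^'m^'m \<Rightarrow> ereal"
  assumes A: "A \<in> sym_mats" and "has_grad_sym f G A" and "has_grad_sym f G' A"
  shows "G = G'"
proof -
  let ?f = "\<lambda>X. real_of_ereal (f X)"
  define H where "H = G - G'"
  have sym: "transpose H = H"
    using assms by (simp add: H_def has_grad_sym_def sym_mats_def transpose_def vec_eq_iff)
  have curve: "((\<lambda>t. ?f (A + t *\<^sub>R H)) has_derivative (\<lambda>s. tr_inner K (s *\<^sub>R H))) (at (0::real))"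
    if K: "has_grad_sym f K A" for K
  proof -
    have sub: "range (\<lambda>t::real. A + t *\<^sub>R H) \<subseteq> sym_mats"
      using A sym by (auto simp: sym_mats_def transpose_def vec_eq_iff)
    have inner: "((\<lambda>t::real. A + t *\<^sub>R H) has_derivative (\<lambda>s. s *\<^sub>R H)) (at 0)"
      by (auto intro!: derivative_eq_intros)
    have outer: "(?f has_derivative (\<lambda>H. tr_inner K H)) (at (A + 0 *\<^sub>R H) within range (\<lambda>t::real. A + t *\<^sub>R H))"
      using K by (auto simp: has_grad_sym_def intro: has_derivative_subset[OF _ sub])
    show ?thesis
      using diff_chain_within[OF inner outer] by (simp add: o_def)
  qed
  have "(\<lambda>s. tr_inner G (s *\<^sub>R H)) = (\<lambda>s::real. tr_inner G' (s *\<^sub>R H))"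
    by (rule has_derivative_unique[OF curve curve]) (use assms in auto)
  then have "tr_inner G (1 *\<^sub>R H) = tr_inner G' (1 *\<^sub>R H)"
    by (rule fun_cong)
  then have "tr_inner H H = 0"
    by (simp add: tr_inner_def H_def trace_def matrix_matrix_mult_def
        sum_subtractf left_diff_distrib)
  moreover have "tr_inner H H = H \<bullet> H"
  proof -
    have *: "H $ i $ j = H $ j $ i" for i j
      using sym by (metis transpose_def vec_lambda_beta)
    show ?thesis
      unfolding tr_inner_def trace_def matrix_matrix_mult_def inner_vec_def
      using * by (simp add: inner_real_def)
  qed
  ultimately show ?thesis by (simp add: H_def)
qed

definition dom_sym :: "(real^'m^'m \<Rightarrow> ereal) \<Rightarrow> (real^'m^'m) set" where
  "dom_sym F = {A \<in> sym_mats. F A < \<infinity>}"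

definition convex_sym :: "(real^'m^'m \<Rightarrow> ereal) \<Rightarrow> bool" where
  "convex_sym F \<longleftrightarrow> (\<forall>A\<in>sym_mats. \<forall>B\<in>sym_mats. \<forall>u. 0 < u \<and> u < 1 \<longrightarrow>
     F ((1 - u) *\<^sub>R A + u *\<^sub>R B) \<le> ereal (1 - u) * F A + ereal u * F B)"

definition lsc_sym :: "(real^'m^'m \<Rightarrow> ereal) \<Rightarrow> bool" where
  "lsc_sym F \<longleftrightarrow> (\<forall>A\<in>sym_mats. F A \<le> Liminf (at A within sym_mats) F)"

definition strictly_convex_on_pd :: "(real^'m^'m \<Rightarrow> ereal) \<Rightarrow> bool" where
  "strictly_convex_on_pd F \<longleftrightarrow>
     (\<forall>A\<in>pd_mats. \<forall>B\<in>pd_mats. \<forall>u. A \<noteq> B \<and> 0 < u \<and> u < 1 \<longrightarrow>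
       F ((1 - u) *\<^sub>R A + u *\<^sub>R B) < ereal (1 - u) * F A + ereal u * F B)"

definition cont_diff_on_pd :: "(real^'m^'m \<Rightarrow> ereal) \<Rightarrow> bool" where
  "cont_diff_on_pd F \<longleftrightarrow>
     (\<forall>A\<in>pd_mats. \<exists>G. has_grad_sym F G A) \<and> continuous_on pd_mats (grad_sym F)"

definition bregman_class :: "(real^'m^'m \<Rightarrow> ereal) set" where
  "bregman_class = {F.
     (\<forall>A\<in>sym_mats. F A \<noteq> -\<infinity>) \<and>
     convex_sym F \<and> (\<exists>A\<in>sym_mats. F A \<noteq> \<infinity>) \<and> lsc_sym F \<and>
     pd_mats \<subseteq> dom_sym F \<and> dom_sym F \<subseteq> psd_mats \<and>
     strictly_convex_on_pd F \<and> cont_diff_on_pd F}"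

definition conj_sym :: "(real^'m^'m \<Rightarrow> ereal) \<Rightarrow> real^'m^'m \<Rightarrow> ereal" where
  "conj_sym F L = (SUP \<Sigma>\<in>sym_mats. ereal (tr_inner \<Sigma> L) - F \<Sigma>)"

definition L_plus :: "(real^'m^'m \<Rightarrow> ereal) \<Rightarrow> (real^'m^'m) set" where
  "L_plus F = grad_sym F ` pd_mats"

definition lin_par :: "('d::finite \<Rightarrow> real^'m^'m) \<Rightarrow> real^'d \<Rightarrow> real^'m^'m" where
  "lin_par A \<theta> = (\<Sum>i\<in>UNIV. \<theta> $ i *\<^sub>R A i)"

definition Theta_plus :: "(real^'m^'m \<Rightarrow> ereal) \<Rightarrow> ('d::finite \<Rightarrow> real^'m^'m) \<Rightarrow> (real^'d) set" where
  "Theta_plus F A = {\<theta>. lin_par A \<theta> \<in> L_plus F}"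

text \<open>Used only for \<open>\<theta> \<in> Theta_plus F A\<close>, where the conjugate is finite; this is the empirical
  objective when \<open>S\<close> is the sample covariance matrix and the population one when \<open>S\<close> is the
  true covariance matrix.\<close>

definition bregman_obj ::
  "(real^'m^'m \<Rightarrow> ereal) \<Rightarrow> ('d::finite \<Rightarrow> real^'m^'m) \<Rightarrow> real^'m^'m \<Rightarrow> real^'d \<Rightarrow> real" where
  "bregman_obj F A S \<theta> = real_of_ereal (conj_sym F (lin_par A \<theta>)) - tr_inner (lin_par A \<theta>) S"

text \<open>\<open>f\<close> is twice differentiable at \<open>x\<close> with Hessian matrix \<open>H\<close>: it is differentiable near \<open>x\<close>,
  and its gradient \<open>g\<close> is differentiable at \<open>x\<close> with Jacobian \<open>H\<close>.\<close>

definition has_hessian :: "(real^'d \<Rightarrow> real) \<Rightarrow> real^'d^'d \<Rightarrow> real^'d \<Rightarrow> bool" where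
  "has_hessian f H x \<longleftrightarrow>
     (\<exists>g. (\<forall>\<^sub>F y in nhds x. (f has_derivative (\<lambda>h. g y \<bullet> h)) (at y)) \<and>
          (g has_derivative (\<lambda>h. H *v h)) (at x))"

definition iid_seq :: "'a measure \<Rightarrow> (nat \<Rightarrow> 'a \<Rightarrow> 'b::topological_space) \<Rightarrow> bool" where
  "iid_seq P X \<longleftrightarrow> prob_space.indep_vars P (\<lambda>_. borel) X UNIV \<and>
     (\<forall>i. distr P borel (X i) = distr P borel (X 0))"

definition cov_matrix :: "'a measure \<Rightarrow> ('a \<Rightarrow> real^'m) \<Rightarrow> real^'m^'m" where
  "cov_matrix P Y = (\<chi> i j. \<integral>\<omega>. (Y \<omega> $ i - (\<integral>\<omega>'. Y \<omega>' $ i \<partial>P)) *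
                              (Y \<omega> $ j - (\<integral>\<omega>'. Y \<omega>' $ j \<partial>P)) \<partial>P)"

text \<open>The sample is indexed from 0: \<open>X 0, \<dots>, X (n - 1)\<close>.\<close>

definition sample_cov :: "(nat \<Rightarrow> 'a \<Rightarrow> real^'m) \<Rightarrow> nat \<Rightarrow> 'a \<Rightarrow> real^'m^'m" where
  "sample_cov X n \<omega> = (1 / real n) *\<^sub>R (\<Sum>i<n. outer_sq (X i \<omega>))"

definition is_bregman_min ::
  "(real^'m^'m \<Rightarrow> ereal) \<Rightarrow> ('d::finite \<Rightarrow> real^'m^'m) \<Rightarrow> real^'m^'m \<Rightarrow> real^'d \<Rightarrow> bool" where
  "is_bregman_min F A S \<theta> \<longleftrightarrow> is_arg_min (bregman_obj F A S) (\<lambda>\<theta>. \<theta> \<in> Theta_plus F A) \<theta>"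

text \<open>The arbitrary value \<open>c\<close> assigned when no minimizer exists may depend on \<open>n\<close> and, measurably,
  on the outcome.  Without measurability the estimator would not be a random vector.\<close>

definition is_bregman_estimator ::
  "'a measure \<Rightarrow> (real^'m^'m \<Rightarrow> ereal) \<Rightarrow> ('d::finite \<Rightarrow> real^'m^'m) \<Rightarrow> (nat \<Rightarrow> 'a \<Rightarrow> real^'m) \<Rightarrow>
   (nat \<Rightarrow> 'a \<Rightarrow> real^'d) \<Rightarrow> bool" where
  "is_bregman_estimator P F A X est \<longleftrightarrow>
     (\<forall>n\<ge>1. \<exists>c\<in>borel_measurable P. \<forall>\<omega>\<in>space P.
        if \<exists>\<theta>. is_bregman_min F A (sample_cov X n \<omega>) \<theta>
        then is_bregman_min F A (sample_cov X n \<omega>) (est n \<omega>)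
        else est n \<omega> = c \<omega>)"

definition fourth_moment_form ::
  "'a measure \<Rightarrow> ('a \<Rightarrow> real^'m) \<Rightarrow> real^'m^'m \<Rightarrow> real^'m^'m \<Rightarrow> real^'m^'m \<Rightarrow> real" where
  "fourth_moment_form P Y \<Sigma> A B =
     (\<integral>\<omega>. tr_inner (outer_sq (Y \<omega>) - \<Sigma>) A * tr_inner (outer_sq (Y \<omega>) - \<Sigma>) B \<partial>P)"

definition std_mvn :: "(real^'d) measure" where
  "std_mvn = density lborel (\<lambda>z. ennreal (\<Prod>i\<in>UNIV. std_normal_density (z $ i)))"

text \<open>The law of \<open>\<mu> + B Z\<close> with \<open>Z\<close> standard normal and \<open>B B\<^sup>T = V\<close>.  For positive semidefinite,
  possibly singular \<open>V\<close>, such a \<open>B\<close> exists and the law does not depend on its choice.\<close>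

definition mvn :: "real^'d \<Rightarrow> real^'d^'d \<Rightarrow> (real^'d) measure" where
  "mvn \<mu> V = distr std_mvn borel (\<lambda>z. \<mu> + (SOME B :: real^'d^'d. B ** transpose B = V) *v z)"

definition converges_in_dist ::
  "'a measure \<Rightarrow> (nat \<Rightarrow> 'a \<Rightarrow> 'b::topological_space) \<Rightarrow> 'b measure \<Rightarrow> bool" where
  "converges_in_dist P Y \<nu> \<longleftrightarrow>
     (\<forall>\<^sub>F n in sequentially. Y n \<in> borel_measurable P) \<and>
     (\<forall>f::'b \<Rightarrow> real. continuous_on UNIV f \<and> bounded (range f) \<longrightarrow>
        (\<lambda>n. \<integral>\<omega>. f (Y n \<omega>) \<partial>P) \<longlonglongrightarrow> (\<integral>x. f x \<partial>\<nu>))"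

end

theory Submission
  imports Defs
begin

text \<open>
  Write \<open>g \<theta> = F\<^sup>* (L \<theta>)\<close>.  The gradient of \<open>F\<close> is strictly monotone and continuous on the positive
  definite matrices, so by invariance of domain its range is open and its inverse continuous
  (\<open>grad_homeomorphism\<close>).  The inverse is a continuous selection of subgradients of the conjugate
  and therefore its gradient (\<open>has_grad_sym_conj\<close>).  Consequently the parameter set is open, and
  \<open>g\<close> is differentiable on it with a gradient \<open>G\<close> (\<open>mean_map\<close>) that is continuous, injective and a
  global subgradient.  The parameter \<open>\<theta>\<close> minimizes \<open>g \<theta> - \<langle>L \<theta>, S\<rangle>\<close> exactly if \<open>G \<theta> = s\<close>, where
  \<open>s\<^sub>i = \<langle>A\<^sub>i, S\<rangle>\<close> (\<open>is_bregman_min_iff\<close>).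

  Invariance of domain in the parameter space gives a continuous inverse \<open>h\<close> of \<open>G\<close> on an open set
  \<open>U\<close>.  So the estimator is \<open>h\<close> of the vector \<open>s\<^sub>n\<close> built from \<open>S\<^sub>n\<close> wherever \<open>s\<^sub>n\<close> lies in \<open>U\<close>, and the
  arbitrary value elsewhere; in particular it is measurable.  At \<open>s\<^sub>0 = G \<theta>\<^sub>0\<close> the function \<open>h\<close> is
  differentiable, with the inverse of the Hessian as its derivative.  Since \<open>sqrt n (s\<^sub>n - s\<^sub>0)\<close> is a
  normalized sum of independent centred vectors with covariance \<open>\<Omega>\<close>, the central limit theorem and
  the delta method give the claim.

  The probabilistic part works with characteristic functions.  The multivariate central limit
  theorem for them is the one-dimensional theorem applied to linear forms (\<open>clt_char_vec\<close>), tightness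
  is Chebyshev's inequality (\<open>iid_sum_tight\<close>), and the passage to bounded continuous test functions
  uses approximation by polynomials in sines (\<open>converges_in_dist_if_char_tendsto\<close>).  The limit law is
  identified by its characteristic function (\<open>char_mvn\<close>), for which a square root of a positive
  semidefinite matrix is needed (\<open>psd_factorization\<close>).
\<close>

section \<open>Trigonometric polynomials and convergence in distribution\<close>

text \<open>Finite sums of complex exponentials with arbitrary real frequency vectors.  They form an
  algebra, and convergence of characteristic functions is convergence of the integrals of all of
  them.\<close>

inductive trig_poly :: "('b::real_inner \<Rightarrow> complex) \<Rightarrow> bool" where
  monom: "trig_poly (\<lambda>x. c * iexp (t \<bullet> x))"
| add: "trig_poly u \<Longrightarrow> trig_poly v \<Longrightarrow> trig_poly (\<lambda>x. u x + v x)"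

lemma trig_poly_const: "trig_poly (\<lambda>x. c)"
  using trig_poly.monom[of c 0] by simp

lemma trig_poly_monom_mult:
  assumes "trig_poly v"
  shows "trig_poly (\<lambda>x. c * iexp (t \<bullet> x) * v x)"
  using assms
proof induction
  case (monom c' t')
  have "(\<lambda>x. c * iexp (t \<bullet> x) * (c' * iexp (t' \<bullet> x))) = (\<lambda>x. (c * c') * iexp ((t + t') \<bullet> x))"
    by (simp add: fun_eq_iff inner_add_left distrib_left exp_add algebra_simps)
  then show ?case by (simp only: trig_poly.monom)
next
  case (add u v)
  then show ?case
    using trig_poly.add[OF add.IH] by (simp add: distrib_left)
qed

lemma trig_poly_mult:
  assumes "trig_poly u" "trig_poly v"
  shows "trig_poly (\<lambda>x. u x * v x)"
  using assms(1)
proof induction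
  case (monom c t)
  then show ?case by (rule trig_poly_monom_mult[OF assms(2)])
next
  case (add u u')
  then show ?case
    using trig_poly.add[OF add.IH] by (simp add: distrib_right)
qed

lemma trig_poly_sum:
  assumes "finite I" "\<And>i. i \<in> I \<Longrightarrow> trig_poly (u i)"
  shows "trig_poly (\<lambda>x. \<Sum>i\<in>I. u i x)"
  using assms
  by (induction I rule: finite_induct) (auto intro: trig_poly_const trig_poly.add)

lemma trig_poly_sin: "trig_poly (\<lambda>x::'b::real_inner. complex_of_real (sin (t \<bullet> x)))"
proof -
  have "complex_of_real (sin (t \<bullet> x)) = (- \<i> / 2) * iexp (t \<bullet> x) + (\<i> / 2) * iexp ((- t) \<bullet> x)" for x
    by (simp add: sin_of_real[symmetric] sin_exp_eq field_simps)
  then show ?thesis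
    using trig_poly.add[OF trig_poly.monom[of "- \<i> / 2" t] trig_poly.monom[of "\<i> / 2" "- t"]]
    by simp
qed

lemma trig_poly_polynomial_of_sines:
  fixes g :: "real^'d \<Rightarrow> real"
  assumes "real_polynomial_function g"
  shows "trig_poly (\<lambda>x::real^'d. complex_of_real (g (\<chi> j. sin (x $ j / R))))"
  using assms
proof induction
  case (linear f)
  have "f y = (\<Sum>j\<in>UNIV. y $ j * f (axis j 1))" for y
  proof -
    have "f y = f (\<Sum>j\<in>UNIV. y $ j *\<^sub>R axis j 1)"
      using basis_expansion[of y] by (simp add: scalar_mult_eq_scaleR)
    also have "\<dots> = (\<Sum>j\<in>UNIV. y $ j * f (axis j 1))"
      using linear by (simp add: linear_simps linear_sum[OF bounded_linear.linear])
    finally show ?thesis .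
  qed
  note expand = this
  have "complex_of_real (f (\<chi> j. sin (x $ j / R)))
      = (\<Sum>j\<in>UNIV. complex_of_real (sin (axis j (1 / R) \<bullet> x)) * complex_of_real (f (axis j 1)))" for x
    by (subst expand) (simp add: inner_axis')
  then show ?case
    by (simp only:) (intro trig_poly_sum trig_poly_mult trig_poly_sin trig_poly_const finite)
next
  case (const c)
  then show ?case by (rule trig_poly_const)
next
  case (add f g)
  then show ?case using trig_poly.add by simp
next
  case (mult f g)
  then show ?case using trig_poly_mult by simp
qed

lemma trig_poly_measurable:
  fixes u :: "'b::euclidean_space \<Rightarrow> complex"
  assumes "trig_poly u"
  shows "u \<in> borel_measurable borel"
  using assms by induction measurable

lemma trig_poly_bounded:
  assumes "trig_poly u"
  shows "\<exists>C. \<forall>x. cmod (u x) \<le> C"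
  using assms
proof induction
  case (monom c t)
  then show ?case by (intro exI[of _ "cmod c"]) (simp add: norm_mult)
next
  case (add u v)
  then obtain C C' where "\<forall>x. cmod (u x) \<le> C" "\<forall>x. cmod (v x) \<le> C'" by auto
  then show ?case by (intro exI[of _ "C + C'"]) (meson add_mono norm_triangle_ineq order_trans)
qed

lemma trig_poly_integrable:
  fixes u :: "'b::euclidean_space \<Rightarrow> complex"
  assumes "trig_poly u" "finite_measure Q" "Y \<in> borel_measurable Q"
  shows "integrable Q (\<lambda>\<omega>. u (Y \<omega>))"
proof -
  obtain C where C: "\<forall>x. cmod (u x) \<le> C" using trig_poly_bounded[OF assms(1)] by auto
  note trig_poly_measurable[OF assms(1), measurable] assms(3)[measurable]
  show ?thesis
    by (rule finite_measure.integrable_const_bound[OF assms(2), where B = C]) (use C in auto)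
qed

lemma trig_poly_integral_tendsto:
  fixes u :: "'b::euclidean_space \<Rightarrow> complex" and Y :: "nat \<Rightarrow> 'a \<Rightarrow> 'b"
  assumes "trig_poly u"
    and P: "finite_measure P" and Q: "finite_measure Q" "sets Q = sets borel"
    and Y: "\<forall>\<^sub>F n in sequentially. Y n \<in> borel_measurable P"
    and cf: "\<And>t. (\<lambda>n. \<integral>\<omega>. iexp (t \<bullet> Y n \<omega>) \<partial>P) \<longlonglongrightarrow> (\<integral>x. iexp (t \<bullet> x) \<partial>Q)"
  shows "(\<lambda>n. \<integral>\<omega>. u (Y n \<omega>) \<partial>P) \<longlonglongrightarrow> (\<integral>x. u x \<partial>Q)"
  using assms(1)
proof induction
  case (monom c t)
  then show ?case using tendsto_mult_left[OF cf, of c t] by simp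
next
  case (add u v)
  have [measurable]: "(\<lambda>x. x) \<in> borel_measurable Q" using Q by simp
  have "(\<lambda>n. (\<integral>\<omega>. u (Y n \<omega>) \<partial>P) + (\<integral>\<omega>. v (Y n \<omega>) \<partial>P)) \<longlonglongrightarrow> (\<integral>x. u x \<partial>Q) + (\<integral>x. v x \<partial>Q)"
    by (intro tendsto_intros add.IH)
  moreover have "(\<integral>x. u x \<partial>Q) + (\<integral>x. v x \<partial>Q) = (\<integral>x. u x + v x \<partial>Q)"
    using trig_poly_integrable[OF add.hyps(1) Q(1), of "\<lambda>x. x"]
      trig_poly_integrable[OF add.hyps(2) Q(1), of "\<lambda>x. x"] by simp
  moreover have "\<forall>\<^sub>F n in sequentially. (\<integral>\<omega>. u (Y n \<omega>) \<partial>P) + (\<integral>\<omega>. v (Y n \<omega>) \<partial>P)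
      = (\<integral>\<omega>. u (Y n \<omega>) + v (Y n \<omega>) \<partial>P)"
    using Y
    by eventually_elim
      (use trig_poly_integrable[OF add.hyps(1) P] trig_poly_integrable[OF add.hyps(2) P] in simp)
  ultimately show ?case
    by (auto intro: Lim_transform_eventually)
qed

text \<open>A bounded continuous function is uniformly close on a given ball to a trigonometric polynomial
  that obeys almost the same bound on the whole space.  The global bound is the point: it comes from
  replacing \<open>f\<close> by the function \<open>f (R arcsin (sin (x\<^sub>j / R)))\<^sub>j\<close>, which agrees with \<open>f\<close> on the ball and
  depends only on the sines \<open>sin (x\<^sub>j / R)\<close>.  These range over a cube, where the Weierstrass theorem
  provides a polynomial.\<close>

lemma trig_poly_approximation:
  fixes f :: "real^'d \<Rightarrow> real"
  assumes f: "continuous_on UNIV f" and B: "\<And>x. \<bar>f x\<bar> \<le> B" and "0 < R" "0 < e"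
  obtains u where "trig_poly u"
    "\<And>x. norm x \<le> R \<Longrightarrow> cmod (u x - f x) < e" "\<And>x. cmod (u x) \<le> B + e"
proof -
  define \<phi> where "\<phi> y = f (\<chi> j. R * arcsin (y $ j))" for y :: "real^'d"
  define K where "K = cbox (\<chi> j::'d. (-1::real)) (\<chi> j. 1)"
  have K: "y \<in> K \<longleftrightarrow> (\<forall>j. \<bar>y $ j\<bar> \<le> 1)" for y
    by (auto simp: K_def mem_box_cart abs_le_iff minus_le_iff)
  have "continuous_on K \<phi>"
    unfolding \<phi>_def
    by (intro continuous_on_compose2[OF f] continuous_intros) (use K in \<open>auto simp: abs_le_iff minus_le_iff\<close>)
  then obtain g where g: "real_polynomial_function g" "\<And>y. y \<in> K \<Longrightarrow> \<bar>\<phi> y - g y\<bar> < e"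
    using Stone_Weierstrass_real_polynomial_function[of K \<phi> e] \<open>0 < e\<close> by (auto simp: K_def)
  define s where "s x = (\<chi> j. sin (x $ j / R))" for x :: "real^'d"
  have sK: "s x \<in> K" for x by (simp add: K s_def)
  show ?thesis
  proof
    show "trig_poly (\<lambda>x. complex_of_real (g (s x)))"
      unfolding s_def by (rule trig_poly_polynomial_of_sines[OF g(1)])
    show "cmod (complex_of_real (g (s x)) - f x) < e" if "norm x \<le> R" for x
    proof -
      have "R * arcsin (sin (x $ j / R)) = x $ j" for j
      proof -
        have "\<bar>x $ j / R\<bar> \<le> 1"
          using component_le_norm_cart[of x j] that \<open>0 < R\<close> by (simp add: field_simps)
        moreover have "1 \<le> pi / 2" using pi_ge_two by simp
        ultimately have "arcsin (sin (x $ j / R)) = x $ j / R"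
          by (intro arcsin_sin) linarith+
        then show ?thesis using \<open>0 < R\<close> by simp
      qed
      then have "\<phi> (s x) = f x" by (simp add: \<phi>_def s_def)
      then show ?thesis
        using g(2)[OF sK, of x] by (simp add: norm_of_real flip: of_real_diff) 
    qed
    show "cmod (complex_of_real (g (s x))) \<le> B + e" for x
      using g(2)[OF sK, of x] B[of "\<chi> j. R * arcsin (s x $ j)"] by (simp add: \<phi>_def)
  qed
qed

text \<open>The part of Levy's continuity theorem needed here: pointwise convergence of characteristic
  functions together with tightness gives convergence in distribution.\<close>

theorem converges_in_dist_if_char_tendsto:
  fixes Y :: "nat \<Rightarrow> 'a \<Rightarrow> real^'d" and Q :: "(real^'d) measure"
  assumes P: "prob_space P" and Q: "prob_space Q" "sets Q = sets borel"
    and Y: "\<forall>\<^sub>F n in sequentially. Y n \<in> borel_measurable P"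
    and cf: "\<And>t. (\<lambda>n. \<integral>\<omega>. iexp (t \<bullet> Y n \<omega>) \<partial>P) \<longlonglongrightarrow> (\<integral>x. iexp (t \<bullet> x) \<partial>Q)"
    and tight: "\<And>e. 0 < e \<Longrightarrow> \<exists>R>0. \<forall>\<^sub>F n in sequentially. measure P {\<omega>\<in>space P. R < norm (Y n \<omega>)} \<le> e"
  shows "converges_in_dist P Y Q"
  unfolding converges_in_dist_def
proof (intro conjI allI impI Y)
  fix f :: "real^'d \<Rightarrow> real"
  assume "continuous_on UNIV f \<and> bounded (range f)"
  then have f: "continuous_on UNIV f" and "bounded (range f)" by auto
  then obtain B where B: "0 < B" "\<And>x. \<bar>f x\<bar> \<le> B"
    by (auto simp: bounded_pos)
  have fm[measurable]: "f \<in> borel_measurable borel" using f by (rule borel_measurable_continuous_onI)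
  interpret P: prob_space P by fact
  interpret Q: prob_space Q by fact
  have spQ: "space Q = UNIV" using Q(2) sets_eq_imp_space_eq by fastforce
  show "(\<lambda>n. \<integral>\<omega>. f (Y n \<omega>) \<partial>P) \<longlonglongrightarrow> (\<integral>x. f x \<partial>Q)"
  proof (rule LIMSEQ_I)
    fix r :: real assume "0 < r"
    \<comment> \<open>replacing \<open>f\<close> by its approximation costs at most \<open>e\<close> on the ball and \<open>2 B + e\<close> off it, an
      event of probability at most \<open>e\<close>; this \<open>e\<close> makes the total at most \<open>r / 4\<close>\<close>
    define e where "e = min 1 (r / (2 * B + 2) / 8)"
    have e: "0 < e" "e \<le> 1" using \<open>0 < r\<close> B by (auto simp: e_def)
    have er: "e * (2 * B + 2) \<le> r / 8"
    proof -
      have "e \<le> r / 8 / (2 * B + 2)" by (simp add: e_def mult.commute)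
      then show ?thesis using B(1) by (simp add: field_simps)
    qed
    obtain R1 where R1: "R1 > 0"
      "\<forall>\<^sub>F n in sequentially. measure P {\<omega>\<in>space P. R1 < norm (Y n \<omega>)} \<le> e"
      using tight[OF e(1)] by auto
    have "(\<lambda>k. measure Q {x. real k < norm x}) \<longlonglongrightarrow> measure Q (\<Inter>k. {x. real k < norm x})"
      by (rule Q.finite_Lim_measure_decseq) (auto simp: Q(2) decseq_def)
    also have "(\<Inter>k. {x::real^'d. real k < norm x}) = {}"
      using reals_Archimedean2 by (auto dest: less_asym)
    finally have "\<forall>\<^sub>F k in sequentially. measure Q {x. real k < norm x} < e"
      using e(1) by (auto dest: order_tendstoD)
    then obtain k where k: "measure Q {x. real k < norm x} < e"
      by (auto simp: eventually_sequentially)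
    define R where "R = max R1 (real k)"
    have "R > 0" using R1 by (simp add: R_def)
    obtain u where u: "trig_poly u" "\<And>x. norm x \<le> R \<Longrightarrow> cmod (u x - f x) < e"
      "\<And>x. cmod (u x) \<le> B + e"
      using trig_poly_approximation[OF f B(2) \<open>0 < R\<close> e(1)] by metis
    \<comment> \<open>the same estimate serves for the laws of the \<open>Y n\<close> and for the limit law\<close>
    have key: "cmod ((\<integral>\<omega>. u (Z \<omega>) \<partial>M) - (\<integral>\<omega>. f (Z \<omega>) \<partial>M)) \<le> r / 4"
      if M: "prob_space M" and Z[measurable]: "Z \<in> borel_measurable M"
        and t: "measure M {\<omega>\<in>space M. R < norm (Z \<omega>)} \<le> e" for M :: "'z measure" and Z
    proof -
      interpret M: prob_space M by fact
      note trig_poly_measurable[OF u(1), measurable]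
      have i1: "integrable M (\<lambda>\<omega>. u (Z \<omega>))" 
        by (rule trig_poly_integrable[OF u(1) _ Z]) unfold_locales
      have i2: "integrable M (\<lambda>\<omega>. f (Z \<omega>))"
        by (rule M.integrable_const_bound[of _ B]) (use B in auto)
      have i3: "integrable M (\<lambda>\<omega>. complex_of_real (f (Z \<omega>)))"
        using i2 by (rule integrable_of_real)
      have bd: "cmod (u x - f x) \<le> e + (2 * B + 1) * indicator {x. R < norm x} x" for x
      proof (cases "norm x \<le> R")
        case True
        then show ?thesis using u(2)[OF True] by simp
      next
        case False
        have "cmod (u x - f x) \<le> cmod (u x) + cmod (f x)" by (rule norm_triangle_ineq4)
        then show ?thesis using u(3)[of x] B(2)[of x] False e by (simp add: indicator_def)
      qed
      have "cmod ((\<integral>\<omega>. u (Z \<omega>) \<partial>M) - (\<integral>\<omega>. f (Z \<omega>) \<partial>M)) = cmod (\<integral>\<omega>. u (Z \<omega>) - f (Z \<omega>) \<partial>M)"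
        using i1 i3 by (simp add: integral_complex_of_real)
      also have "\<dots> \<le> (\<integral>\<omega>. e + (2 * B + 1) * indicator {\<omega>\<in>space M. R < norm (Z \<omega>)} \<omega> \<partial>M)"
      proof (rule order_trans[OF integral_norm_bound integral_mono])
        show "integrable M (\<lambda>\<omega>. e + (2 * B + 1) * indicator {\<omega>\<in>space M. R < norm (Z \<omega>)} \<omega>)"
          by (intro Bochner_Integration.integrable_add integrable_mult_right)
            (auto simp: less_top[symmetric])
        show "cmod (u (Z \<omega>) - f (Z \<omega>)) \<le> e + (2 * B + 1) * indicator {\<omega>\<in>space M. R < norm (Z \<omega>)} \<omega>"
          if "\<omega> \<in> space M" for \<omega>
          using bd[of "Z \<omega>"] that by (simp add: indicator_def)
      qed (use i1 i3 in auto)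
      also have "\<dots> = e + (2 * B + 1) * measure M {\<omega>\<in>space M. R < norm (Z \<omega>)}"
        by (subst Bochner_Integration.integral_add)
          (auto simp: less_top[symmetric] M.prob_space intro!: integrable_mult_right)
      also have "\<dots> \<le> e + (2 * B + 1) * e"
        using t B(1) by (intro add_left_mono mult_left_mono) auto
      also have "\<dots> \<le> r / 4" using er \<open>0 < r\<close> by (simp add: algebra_simps)
      finally show ?thesis .
    qed
    have Qk: "cmod ((\<integral>x. u x \<partial>Q) - (\<integral>x. f x \<partial>Q)) \<le> r / 4"
    proof (rule key[OF Q(1)])
      show "(\<lambda>x. x) \<in> borel_measurable Q" using Q(2) by simp
      have "measure Q {x. R < norm x} \<le> measure Q {x. real k < norm x}"
        by (rule Q.finite_measure_mono) (auto simp: R_def Q(2))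
      then show "measure Q {x \<in> space Q. R < norm x} \<le> e" using k by (simp add: spQ)
    qed
    have "(\<lambda>n. \<integral>\<omega>. u (Y n \<omega>) \<partial>P) \<longlonglongrightarrow> (\<integral>x. u x \<partial>Q)"
      by (rule trig_poly_integral_tendsto[OF u(1) _ _ Q(2) Y cf]) unfold_locales
    then have "\<forall>\<^sub>F n in sequentially. cmod ((\<integral>\<omega>. u (Y n \<omega>) \<partial>P) - (\<integral>x. u x \<partial>Q)) < r / 4"
      using \<open>0 < r\<close> by (auto simp: tendsto_iff dist_norm dest: spec[of _ "r / 4"])
    then have "\<forall>\<^sub>F n in sequentially. norm ((\<integral>\<omega>. f (Y n \<omega>) \<partial>P) - (\<integral>x. f x \<partial>Q)) < r"
      using R1(2) Y
    proof eventually_elim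
      case (elim n)
      note [measurable] = elim(3)
      have "measure P {\<omega>\<in>space P. R < norm (Y n \<omega>)} \<le> measure P {\<omega>\<in>space P. R1 < norm (Y n \<omega>)}"
        by (rule P.finite_measure_mono) (auto simp: R_def)
      then have a: "cmod ((\<integral>\<omega>. u (Y n \<omega>) \<partial>P) - (\<integral>\<omega>. f (Y n \<omega>) \<partial>P)) \<le> r / 4"
        using elim by (intro key[OF P]) auto
      have "norm ((\<integral>\<omega>. f (Y n \<omega>) \<partial>P) - (\<integral>x. f x \<partial>Q))
          = cmod (complex_of_real (\<integral>\<omega>. f (Y n \<omega>) \<partial>P) - complex_of_real (\<integral>x. f x \<partial>Q))"
        by (simp flip: of_real_diff)
      also have "\<dots> \<le> cmod ((\<integral>\<omega>. f (Y n \<omega>) \<partial>P) - (\<integral>\<omega>. u (Y n \<omega>) \<partial>P))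
          + cmod ((\<integral>\<omega>. u (Y n \<omega>) \<partial>P) - (\<integral>x. u x \<partial>Q)) + cmod ((\<integral>x. u x \<partial>Q) - (\<integral>x. f x \<partial>Q))"
        by (rule order_trans[OF _ add_mono[OF norm_triangle_ineq order_refl]],
            rule order_trans[OF _ norm_triangle_ineq]) simp
      also have "\<dots> < r"
        using a[unfolded norm_minus_commute[of "\<integral>\<omega>. u (Y n \<omega>) \<partial>P"]] Qk elim(1) \<open>0 < r\<close> by linarith
      finally show ?case .
    qed
    then show "\<exists>no. \<forall>n\<ge>no. norm ((\<integral>\<omega>. f (Y n \<omega>) \<partial>P) - (\<integral>x. f x \<partial>Q)) < r"
      by (simp add: eventually_sequentially)
  qed
qed

section \<open>The multivariate normal distribution\<close>

lemma prod_Basis_vec: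
  fixes g :: "real^'d \<Rightarrow> 'c::comm_monoid_mult"
  shows "(\<Prod>b\<in>Basis. g b) = (\<Prod>i\<in>UNIV. g (axis i 1))"
proof -
  have "(Basis :: (real^'d) set) = (\<lambda>i. axis i 1) ` UNIV"
    by (auto simp: Basis_vec_def)
  moreover have "inj (\<lambda>i::'d. axis i (1::real))"
    by (simp add: inj_on_def axis_eq_axis)
  ultimately show ?thesis
    using prod.reindex[of "\<lambda>i::'d. axis i (1::real)" UNIV g] by (simp add: o_def)
qed

lemma nn_integral_lborel_prod_vec:
  fixes f :: "'d::finite \<Rightarrow> real \<Rightarrow> ennreal"
  assumes [measurable]: "\<And>i. f i \<in> borel_measurable borel"
  shows "(\<integral>\<^sup>+z. (\<Prod>i\<in>UNIV. f i (z $ i)) \<partial>(lborel :: (real^'d) measure)) = (\<Prod>i\<in>UNIV. \<integral>\<^sup>+x. f i x \<partial>lborel)"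
proof -
  define k where "k b = (THE i. b = axis i (1::real))" for b :: "real^'d"
  have k: "k (axis i 1) = i" for i
    by (auto simp: k_def axis_eq_axis intro!: the_equality)
  have "(\<integral>\<^sup>+z. (\<Prod>i\<in>UNIV. f i (z $ i)) \<partial>(lborel :: (real^'d) measure))
      = (\<integral>\<^sup>+z. (\<Prod>b\<in>Basis. f (k b) (z \<bullet> b)) \<partial>(lborel :: (real^'d) measure))"
    by (simp add: prod_Basis_vec k inner_axis)
  also have "\<dots> = (\<Prod>b\<in>(Basis :: (real^'d) set). \<integral>\<^sup>+x. f (k b) x \<partial>lborel)"
    by (rule nn_integral_lborel_prod) auto
  finally show ?thesis by (simp add: prod_Basis_vec k)
qed

lemma integral_lborel_prod_vec:
  fixes f :: "'d::finite \<Rightarrow> real \<Rightarrow> complex"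
  assumes f: "\<And>i. integrable lborel (f i)"
  shows "(\<integral>z. (\<Prod>i\<in>UNIV. f i (z $ i)) \<partial>(lborel :: (real^'d) measure)) = (\<Prod>i\<in>UNIV. \<integral>x. f i x \<partial>lborel)"
proof -
  define k where "k b = (THE i. b = axis i (1::real))" for b :: "real^'d"
  have k: "k (axis i 1) = i" for i
    by (auto simp: k_def axis_eq_axis intro!: the_equality)
  have [measurable]: "f i \<in> borel_measurable borel" for i
    using borel_measurable_integrable[OF f[of i]] by simp
  interpret product_sigma_finite "\<lambda>b::real^'d. lborel :: real measure" ..
  have "(\<integral>z. (\<Prod>i\<in>UNIV. f i (z $ i)) \<partial>(lborel :: (real^'d) measure))
      = (\<integral>z. (\<Prod>b\<in>Basis. f (k b) (z \<bullet> b)) \<partial>(lborel :: (real^'d) measure))"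
    by (simp add: prod_Basis_vec k inner_axis)
  also have "\<dots> = (\<integral>x. (\<Prod>b\<in>Basis. f (k b) ((\<Sum>c\<in>Basis. x c *\<^sub>R c) \<bullet> b)) \<partial>(\<Pi>\<^sub>M b\<in>(Basis :: (real^'d) set). lborel))"
    by (subst lborel_eq, subst integral_distr) auto
  also have "\<dots> = (\<integral>x. (\<Prod>b\<in>Basis. f (k b) (x b)) \<partial>(\<Pi>\<^sub>M b\<in>(Basis :: (real^'d) set). lborel))"
    by (intro Bochner_Integration.integral_cong prod.cong) (auto simp: inner_sum_left_Basis)
  also have "\<dots> = (\<Prod>b\<in>(Basis :: (real^'d) set). \<integral>x. f (k b) x \<partial>lborel)"
    by (rule product_integral_prod) (use f in auto)
  finally show ?thesis by (simp add: prod_Basis_vec k)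
qed

lemma borel_measurable_matrix_vector_mult [measurable]:
  "(\<lambda>z. (M :: real^'n^'m) *v z) \<in> borel_measurable borel"
  by (intro borel_measurable_continuous_onI continuous_intros)

lemma sets_std_mvn [measurable_cong, simp]: "sets std_mvn = sets borel"
  by (simp add: std_mvn_def)

lemma space_std_mvn [simp]: "space std_mvn = UNIV"
  by (simp add: std_mvn_def)

lemma prob_space_std_mvn: "prob_space (std_mvn :: (real^'d) measure)"
proof
  have "emeasure (std_mvn :: (real^'d) measure) UNIV
      = (\<integral>\<^sup>+z. (\<Prod>i\<in>UNIV. ennreal (std_normal_density (z $ i))) \<partial>(lborel :: (real^'d) measure))"
    by (simp add: std_mvn_def emeasure_density prod_ennreal normal_density_nonneg)
  also have "\<dots> = (\<Prod>i\<in>(UNIV :: 'd set). \<integral>\<^sup>+x. ennreal (std_normal_density x) \<partial>lborel)"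
    by (rule nn_integral_lborel_prod_vec) auto
  also have "\<dots> = 1"
    by (simp add: nn_integral_eq_integral integrable_normal_density integral_normal_density)
  finally show "emeasure (std_mvn :: (real^'d) measure) (space std_mvn) = 1" by simp
qed

lemma char_std_mvn:
  fixes t :: "real^'d"
  shows "(\<integral>z. iexp (t \<bullet> z) \<partial>std_mvn) = exp (- (norm t)\<^sup>2 / 2)"
proof -
  define f where "f i x = std_normal_density x *\<^sub>R iexp (t $ i * x)" for i x
  have "(\<integral>x. f i x \<partial>lborel) = char std_normal_distribution (t $ i)" for i
    unfolding char_def f_def by (subst integral_density) auto
  then have int: "(\<integral>x. f i x \<partial>lborel) = exp (- (t $ i)\<^sup>2 / 2)" for i
    by (simp add: char_std_normal_distribution)
  have f: "integrable lborel (f i)" for i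
  proof (rule Bochner_Integration.integrable_bound)
    show "integrable lborel std_normal_density" by (simp add: integrable_normal_density)
  qed (unfold f_def, auto)
  have "(\<integral>z. iexp (t \<bullet> z) \<partial>std_mvn)
      = (\<integral>z. (\<Prod>i\<in>UNIV. std_normal_density (z $ i)) *\<^sub>R iexp (t \<bullet> z) \<partial>lborel)"
    unfolding std_mvn_def by (subst integral_density) (auto intro!: AE_I2 prod_nonneg)
  also have "\<dots> = (\<integral>z. (\<Prod>i\<in>UNIV. f i (z $ i)) \<partial>(lborel :: (real^'d) measure))"
    by (simp add: f_def inner_vec_def prod.distrib scaleR_conv_of_real exp_sum sum_distrib_left)
  also have "\<dots> = (\<Prod>i\<in>UNIV. complex_of_real (exp (- (t $ i)\<^sup>2 / 2)))"
    by (simp add: integral_lborel_prod_vec f int)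
  also have "\<dots> = exp (\<Sum>i\<in>UNIV. - (t $ i)\<^sup>2 / 2)"
    by (subst exp_sum) (simp_all add: exp_of_real)
  also have "(\<Sum>i\<in>UNIV. - (t $ i)\<^sup>2 / 2) = - (norm t)\<^sup>2 / 2"
    unfolding power2_norm_eq_inner
    by (simp add: inner_vec_def power2_eq_square sum_negf sum_divide_distrib)
  finally show ?thesis by simp
qed

text \<open>Cholesky factorization, by induction on an index set outside of which the rows vanish.  A
  nonzero pivot \<open>V\<^sub>k\<^sub>k\<close> is split off as the rank one matrix of the column \<open>V\<^sub>k / sqrt V\<^sub>k\<^sub>k\<close>, and the Schur
  complement remains positive semidefinite.  A zero pivot forces the whole row to vanish.\<close>

lemma psd_sum_of_outer_products:
  fixes V :: "real^'d^'d"
  assumes "finite S" and "V \<in> psd_mats" and "\<And>i j. i \<notin> S \<Longrightarrow> V $ i $ j = 0"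
  shows "\<exists>w. V = (\<Sum>k\<in>S. outer_sq (w k))"
  using assms
proof (induction S arbitrary: V rule: finite_induct)
  case empty
  then show ?case by (simp add: vec_eq_iff)
next
  case (insert k S)
  have sym: "V $ i $ j = V $ j $ i" for i j
    using insert.prems(1) by (metis (mono_tags, lifting) mem_Collect_eq psd_mats_def sym_mats_def transpose_def vec_lambda_beta)
  have psd: "0 \<le> x \<bullet> (V *v x)" for x
    using insert.prems(1) by (simp add: psd_mats_def)
  have V_axis: "V *v axis k 1 = V $ k"
    by (simp add: matrix_vector_mul_component vec_eq_iff matrix_vector_mult_basis column_def sym)
  have quad: "(x + c *\<^sub>R axis k 1) \<bullet> (V *v (x + c *\<^sub>R axis k 1))
      = x \<bullet> (V *v x) + 2 * c * (V $ k \<bullet> x) + c\<^sup>2 * V $ k $ k" for x c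
  proof -
    have "axis k 1 \<bullet> (V *v x) = V $ k \<bullet> x"
      by (simp add: inner_axis' matrix_vector_mul_component)
    then show ?thesis
      by (simp add: matrix_vector_right_distrib matrix_vector_mult_scaleR V_axis inner_add_left
          inner_add_right inner_axis' algebra_simps power2_eq_square inner_commute)
  qed
  show ?case
  proof (cases "V $ k $ k = 0")
    case True
    have "V $ k \<bullet> x = 0" for x
    proof (rule ccontr)
      assume a: "V $ k \<bullet> x \<noteq> 0"
      \<comment> \<open>with zero pivot the quadratic form is affine in \<open>c\<close>; this \<open>c\<close> makes it equal to \<open>-1\<close>\<close>
      define c where "c = - (x \<bullet> (V *v x) + 1) / (2 * (V $ k \<bullet> x))"
      have "2 * c * (V $ k \<bullet> x) = - (x \<bullet> (V *v x) + 1)"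
        using a by (simp add: c_def field_simps)
      then show False using psd[of "x + c *\<^sub>R axis k 1"] by (simp add: quad True)
    qed
    then have "V $ k = 0" by (metis inner_eq_zero_iff)
    then have "V $ i $ j = 0" if "i \<notin> S" for i j
      using insert.prems(2)[of i j] that by (cases "i = k") auto
    from insert.IH[OF insert.prems(1) this] obtain w where w: "V = (\<Sum>k\<in>S. outer_sq (w k))" by auto
    have "V = (\<Sum>i\<in>insert k S. outer_sq ((w(k := 0)) i))"
      using insert.hyps by (subst w) (auto simp: outer_sq_def vec_eq_iff intro!: sum.cong)
    then show ?thesis by blast
  next
    case False
    have "0 \<le> V $ k $ k"
      using psd[of "axis k 1"] by (simp add: V_axis inner_axis')
    with False have pos: "0 < V $ k $ k" by simp
    define v where "v = (1 / sqrt (V $ k $ k)) *\<^sub>R V $ k"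
    define V' where "V' = V - outer_sq v"
    have vv: "v $ i * v $ j = V $ k $ i * V $ k $ j / V $ k $ k" for i j
      using pos by (simp add: v_def)
    have V'_zero: "V' $ i $ j = 0" if "i \<notin> S" for i j
      using insert.prems(2)[of i j] insert.prems(2)[of i k] that pos sym[of k i]
      by (cases "i = k") (simp_all add: V'_def outer_sq_def vv)
    have "0 \<le> x \<bullet> (V' *v x)" for x
    proof -
      \<comment> \<open>the minimizer over \<open>c\<close> of the quadratic form at \<open>x + c e\<^sub>k\<close>\<close>
      define c where "c = - (V $ k \<bullet> x) / V $ k $ k"
      have "x \<bullet> (outer_sq v *v x) = (v \<bullet> x)\<^sup>2"
        by (simp add: outer_sq_def inner_vec_def matrix_vector_mult_def power2_eq_square
            sum_product sum_distrib_left algebra_simps)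
      also have "\<dots> = (V $ k \<bullet> x)\<^sup>2 / V $ k $ k"
        using pos by (simp add: v_def power_divide)
      finally have "x \<bullet> (V' *v x) = (x + c *\<^sub>R axis k 1) \<bullet> (V *v (x + c *\<^sub>R axis k 1))"
        using pos unfolding quad
        by (simp add: V'_def matrix_vector_mult_diff_rdistrib inner_diff_right c_def field_simps power2_eq_square)
      then show ?thesis using psd by simp
    qed
    moreover have "transpose V' = V'"
      using sym by (simp add: V'_def outer_sq_def transpose_def vec_eq_iff)
    ultimately have "V' \<in> psd_mats" by (simp add: psd_mats_def sym_mats_def)
    from insert.IH[OF this V'_zero] obtain w where w: "V' = (\<Sum>k\<in>S. outer_sq (w k))" by auto
    have "V = (\<Sum>i\<in>insert k S. outer_sq ((w(k := v)) i))"
    proof -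
      have "(\<Sum>i\<in>S. outer_sq ((w(k := v)) i)) = V'"
        unfolding w using insert.hyps by (intro sum.cong) auto
      then show ?thesis using insert.hyps by (simp add: V'_def)
    qed
    then show ?thesis by blast
  qed
qed

text \<open>Hence the choice made in the definition of \<^const>\<open>mvn\<close> is of an existing matrix.\<close>

lemma psd_factorization:
  fixes V :: "real^'d^'d"
  assumes "V \<in> psd_mats"
  shows "\<exists>B :: real^'d^'d. B ** transpose B = V"
proof -
  obtain w where "V = (\<Sum>k\<in>(UNIV :: 'd set). outer_sq (w k))"
    using psd_sum_of_outer_products[OF finite assms] by auto
  then have "(\<chi> i k. w k $ i) ** transpose (\<chi> i k. w k $ i) = V"
    by (simp add: vec_eq_iff matrix_matrix_mult_def transpose_def outer_sq_def)
  then show ?thesis by blast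
qed

lemma sets_mvn: "sets (mvn \<mu> V) = sets borel"
  by (simp add: mvn_def)

lemma prob_space_mvn: "prob_space (mvn \<mu> V)"
  unfolding mvn_def
  by (rule prob_space.prob_space_distr[OF prob_space_std_mvn]) measurable

lemma char_mvn:
  fixes V :: "real^'d^'d" and t :: "real^'d"
  assumes "V \<in> psd_mats"
  shows "(\<integral>x. iexp (t \<bullet> x) \<partial>mvn 0 V) = exp (- (t \<bullet> (V *v t)) / 2)"
proof -
  define B :: "real^'d^'d" where "B = (SOME B. B ** transpose B = V)"
  have B: "B ** transpose B = V"
    unfolding B_def by (rule someI_ex[OF psd_factorization[OF assms]])
  have "(\<integral>x. iexp (t \<bullet> x) \<partial>mvn 0 V) = (\<integral>z. iexp ((transpose B *v t) \<bullet> z) \<partial>std_mvn)"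
    unfolding mvn_def B_def[symmetric]
    by (subst integral_distr) (auto simp: dot_lmul_matrix[symmetric])
  also have "\<dots> = exp (- (norm (transpose B *v t))\<^sup>2 / 2)"
    by (rule char_std_mvn)
  also have "(norm (transpose B *v t))\<^sup>2 = t \<bullet> (V *v t)"
    by (simp add: power2_norm_eq_inner B[symmetric] matrix_vector_mul_assoc[symmetric] dot_lmul_matrix[symmetric])
  finally show ?thesis .
qed

section \<open>The multivariate central limit theorem for characteristic functions\<close>

context prob_space
begin

text \<open>The one-dimensional theorem, including the degenerate variance \<open>v = 0\<close>, in which all summands
  vanish almost surely.\<close>

lemma clt_char_real:
  fixes W :: "nat \<Rightarrow> 'a \<Rightarrow> real"
  assumes indep: "indep_vars (\<lambda>_. borel) W UNIV"
    and mean: "\<And>k. expectation (W k) = 0"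
    and int2: "\<And>k. integrable M (\<lambda>\<omega>. (W k \<omega>)\<^sup>2)"
    and var: "\<And>k. expectation (\<lambda>\<omega>. (W k \<omega>)\<^sup>2) = v"
    and dist: "\<And>k. distr M borel (W k) = distr M borel (W 0)"
  shows "(\<lambda>n. \<integral>\<omega>. iexp ((\<Sum>k<n. W k \<omega>) / sqrt n) \<partial>M) \<longlonglongrightarrow> exp (- v / 2)"
proof -
  have W[measurable]: "W k \<in> borel_measurable M" for k
    using indep unfolding indep_vars_def2 by simp
  have "0 \<le> v" unfolding var[of 0, symmetric] by simp
  then consider "v = 0" | "0 < v" by linarith
  then show ?thesis
  proof cases
    case 1
    have "AE \<omega> in M. W k \<omega> = 0" for k
      using integral_nonneg_eq_0_iff_AE[OF int2[of k]] var[of k] 1 by simp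
    then have "AE \<omega> in M. \<forall>k. W k \<omega> = 0" by (simp add: AE_all_countable)
    then have "(\<integral>\<omega>. iexp ((\<Sum>k<n. W k \<omega>) / sqrt n) \<partial>M) = (\<integral>\<omega>. 1 \<partial>M)" for n
      by (intro integral_cong_AE) auto
    then show ?thesis using 1 by (simp add: prob_space)
  next
    case 2
    have sq: "(sqrt v)\<^sup>2 = v" using 2 by simp
    have "weak_conv_m (\<lambda>n. distr M borel (\<lambda>\<omega>. (\<Sum>k<n. W k \<omega>) / sqrt (n * (sqrt v)\<^sup>2))) std_normal_distribution"
    proof (rule central_limit_theorem_zero_mean[OF indep mean _ int2 _ dist])
      show "0 < sqrt v" using 2 by simp
      show "variance (W k) = (sqrt v)\<^sup>2" for k using mean var sq by simp
    qed
    then have "(\<lambda>n. char (distr M borel (\<lambda>\<omega>. (\<Sum>k<n. W k \<omega>) / sqrt (n * (sqrt v)\<^sup>2))) (sqrt v))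
        \<longlonglongrightarrow> char std_normal_distribution (sqrt v)"
      by (intro levy_continuity1 real_distribution_distr real_dist_normal_dist) measurable
    moreover have "char (distr M borel (\<lambda>\<omega>. (\<Sum>k<n. W k \<omega>) / sqrt (n * (sqrt v)\<^sup>2))) (sqrt v)
        = (\<integral>\<omega>. iexp ((\<Sum>k<n. W k \<omega>) / sqrt n) \<partial>M)" for n
      unfolding char_def using 2 by (subst integral_distr) (auto simp: real_sqrt_mult)
    moreover have "char std_normal_distribution (sqrt v) = exp (- v / 2)"
      using 2 by (simp add: char_std_normal_distribution exp_of_real)
    ultimately show ?thesis by simp
  qed
qed

lemma expectation_square_sum_indep:
  fixes W :: "nat \<Rightarrow> 'a \<Rightarrow> real"
  assumes indep: "indep_vars (\<lambda>_. borel) W UNIV"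
    and mean: "\<And>k. expectation (W k) = 0"
    and int2: "\<And>k. integrable M (\<lambda>\<omega>. (W k \<omega>)\<^sup>2)"
    and var: "\<And>k. expectation (\<lambda>\<omega>. (W k \<omega>)\<^sup>2) = v"
  shows "integrable M (\<lambda>\<omega>. (\<Sum>k<n. W k \<omega>)\<^sup>2)" 
    and "expectation (\<lambda>\<omega>. (\<Sum>k<n. W k \<omega>)\<^sup>2) = real n * v"
proof -
  have W[measurable]: "W k \<in> borel_measurable M" for k
    using indep unfolding indep_vars_def2 by simp
  have int1: "integrable M (W k)" for k
    by (rule square_integrable_imp_integrable[OF W int2])
  have cross: "integrable M (\<lambda>\<omega>. W j \<omega> * W k \<omega>) \<and>
      expectation (\<lambda>\<omega>. W j \<omega> * W k \<omega>) = (if j = k then v else 0)" for j k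
  proof (cases "j = k")
    case True
    then show ?thesis using int2[of k] var[of k] by (simp add: power2_eq_square)
  next
    case False
    have "indep_vars (\<lambda>_. borel) W {j, k}"
      by (rule indep_vars_subset[OF indep]) simp
    then show ?thesis
      using indep_vars_integrable[of "{j, k}" W] indep_vars_lebesgue_integral[of "{j, k}" W]
        int1 mean False by simp
  qed
  have eq: "(\<Sum>k<n. W k \<omega>)\<^sup>2 = (\<Sum>j<n. \<Sum>k<n. W j \<omega> * W k \<omega>)" for \<omega>
    by (simp add: power2_eq_square sum_product)
  show "integrable M (\<lambda>\<omega>. (\<Sum>k<n. W k \<omega>)\<^sup>2)"
    unfolding eq using cross by (intro Bochner_Integration.integrable_sum) auto
  have "expectation (\<lambda>\<omega>. (\<Sum>k<n. W k \<omega>)\<^sup>2) = (\<Sum>j<n. \<Sum>k<n. if j = k then v else 0)"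
    unfolding eq using cross by (simp add: Bochner_Integration.integral_sum)
  also have "\<dots> = real n * v" by simp
  finally show "expectation (\<lambda>\<omega>. (\<Sum>k<n. W k \<omega>)\<^sup>2) = real n * v" .
qed

context
  fixes \<xi> :: "nat \<Rightarrow> 'a \<Rightarrow> real^'d"
  assumes indep: "indep_vars (\<lambda>_. borel) \<xi> UNIV"
    and dist: "\<And>k. distr M borel (\<xi> k) = distr M borel (\<xi> 0)"
    and mean: "\<And>i. expectation (\<lambda>\<omega>. \<xi> 0 \<omega> $ i) = 0"
    and int2: "\<And>i. integrable M (\<lambda>\<omega>. (\<xi> 0 \<omega> $ i)\<^sup>2)"
begin

text \<open>Cramer--Wold: the scalar products with a fixed vector satisfy the hypotheses of the
  one-dimensional statements.\<close>

lemma iid_projection: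
  fixes t :: "real^'d"
  defines "W \<equiv> \<lambda>k \<omega>. t \<bullet> \<xi> k \<omega>"
  shows "indep_vars (\<lambda>_. borel) W UNIV"
    and "expectation (W k) = 0"
    and "integrable M (\<lambda>\<omega>. (W k \<omega>)\<^sup>2)"
    and "expectation (\<lambda>\<omega>. (W k \<omega>)\<^sup>2) = t \<bullet> ((\<chi> i j. expectation (\<lambda>\<omega>. \<xi> 0 \<omega> $ i * \<xi> 0 \<omega> $ j)) *v t)"
    and "distr M borel (W k) = distr M borel (W 0)"
proof -
  have \<xi>[measurable]: "\<xi> k \<in> borel_measurable M" for k
    using indep unfolding indep_vars_def2 by simp
  show "indep_vars (\<lambda>_. borel) W UNIV"
    unfolding W_def by (rule indep_vars_compose2[OF indep]) measurable
  have transfer: "expectation (\<lambda>\<omega>. h (\<xi> k \<omega>)) = expectation (\<lambda>\<omega>. h (\<xi> 0 \<omega>))"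
    "integrable M (\<lambda>\<omega>. h (\<xi> k \<omega>)) \<longleftrightarrow> integrable M (\<lambda>\<omega>. h (\<xi> 0 \<omega>))"
    if [measurable]: "h \<in> borel_measurable borel" for h :: "real^'d \<Rightarrow> real"
  proof -
    show "expectation (\<lambda>\<omega>. h (\<xi> k \<omega>)) = expectation (\<lambda>\<omega>. h (\<xi> 0 \<omega>))"
      using integral_distr[OF \<xi>[of k] that] integral_distr[OF \<xi>[of 0] that] dist[of k] by simp
    show "integrable M (\<lambda>\<omega>. h (\<xi> k \<omega>)) \<longleftrightarrow> integrable M (\<lambda>\<omega>. h (\<xi> 0 \<omega>))"
      using integrable_distr_eq[OF \<xi>[of k] that] integrable_distr_eq[OF \<xi>[of 0] that] dist[of k] by simp
  qed
  have [measurable]: "(\<lambda>\<omega>. \<xi> 0 \<omega> $ i) \<in> borel_measurable M" for i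
    by (rule measurable_compose[OF \<xi>]) (intro borel_measurable_continuous_onI continuous_intros)
  have int1: "integrable M (\<lambda>\<omega>. \<xi> 0 \<omega> $ i)" for i
    by (rule square_integrable_imp_integrable[OF _ int2]) measurable
  have int11: "integrable M (\<lambda>\<omega>. \<xi> 0 \<omega> $ i * \<xi> 0 \<omega> $ j)" for i j
  proof (rule Bochner_Integration.integrable_bound)
    show "integrable M (\<lambda>\<omega>. (\<xi> 0 \<omega> $ i)\<^sup>2 + (\<xi> 0 \<omega> $ j)\<^sup>2)" using int2 by simp
    have "norm (x * y) \<le> norm (x\<^sup>2 + y\<^sup>2)" for x y :: real
    proof -
      have "0 \<le> (\<bar>x\<bar> - \<bar>y\<bar>)\<^sup>2" "0 \<le> \<bar>x\<bar> * \<bar>y\<bar>" by auto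
      then have "\<bar>x\<bar> * \<bar>y\<bar> \<le> x\<^sup>2 + y\<^sup>2"
        by (simp only: power2_diff power2_abs)
      then show ?thesis by (simp add: abs_mult)
    qed
    then show "AE \<omega> in M. norm (\<xi> 0 \<omega> $ i * \<xi> 0 \<omega> $ j) \<le> norm ((\<xi> 0 \<omega> $ i)\<^sup>2 + (\<xi> 0 \<omega> $ j)\<^sup>2)"
      by simp
  qed measurable
  have W_sq: "(W 0 \<omega>)\<^sup>2 = (\<Sum>i\<in>UNIV. \<Sum>j\<in>UNIV. t $ i * t $ j * (\<xi> 0 \<omega> $ i * \<xi> 0 \<omega> $ j))" for \<omega>
    by (simp add: W_def inner_vec_def power2_eq_square sum_product algebra_simps)
  have "expectation (W 0) = 0"
    unfolding W_def inner_vec_def using int1 mean by (simp add: Bochner_Integration.integral_sum)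
  then show "expectation (W k) = 0"
    using transfer(1)[of "\<lambda>x. t \<bullet> x"] by (simp add: W_def)
  have "integrable M (\<lambda>\<omega>. (W 0 \<omega>)\<^sup>2)"
    unfolding W_sq using int11 by (intro Bochner_Integration.integrable_sum integrable_mult_right)
  then show "integrable M (\<lambda>\<omega>. (W k \<omega>)\<^sup>2)"
    using transfer(2)[of "\<lambda>x. (t \<bullet> x)\<^sup>2"] by (simp add: W_def)
  have "expectation (\<lambda>\<omega>. (W 0 \<omega>)\<^sup>2) = t \<bullet> ((\<chi> i j. expectation (\<lambda>\<omega>. \<xi> 0 \<omega> $ i * \<xi> 0 \<omega> $ j)) *v t)"
    unfolding W_sq using int11
    by (simp add: Bochner_Integration.integral_sum Bochner_Integration.integrable_sum
        inner_vec_def matrix_vector_mult_def sum_distrib_left algebra_simps)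
  then show "expectation (\<lambda>\<omega>. (W k \<omega>)\<^sup>2) = t \<bullet> ((\<chi> i j. expectation (\<lambda>\<omega>. \<xi> 0 \<omega> $ i * \<xi> 0 \<omega> $ j)) *v t)"
    using transfer(1)[of "\<lambda>x. (t \<bullet> x)\<^sup>2"] by (simp add: W_def)
  have "distr M borel (W k) = distr (distr M borel (\<xi> k)) borel (\<lambda>x. t \<bullet> x)" for k
    unfolding W_def by (subst distr_distr) (auto simp: o_def)
  then show "distr M borel (W k) = distr M borel (W 0)"
    using dist[of k] by simp
qed

theorem clt_char_vec:
  "(\<lambda>n. \<integral>\<omega>. iexp (t \<bullet> ((1 / sqrt n) *\<^sub>R (\<Sum>k<n. \<xi> k \<omega>))) \<partial>M)
     \<longlonglongrightarrow> exp (- (t \<bullet> ((\<chi> i j. expectation (\<lambda>\<omega>. \<xi> 0 \<omega> $ i * \<xi> 0 \<omega> $ j)) *v t)) / 2)"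
  using clt_char_real[OF iid_projection(1-5)] by (simp add: inner_sum_right)

text \<open>Chebyshev's inequality; for \<open>n \<ge> 1\<close> the normalized sums have the second moments of a single summand.\<close>

theorem iid_sum_tight:
  assumes "0 < e"
  shows "\<exists>R>0. \<forall>n. prob {\<omega>\<in>space M. R < norm ((1 / sqrt n) *\<^sub>R (\<Sum>k<n. \<xi> k \<omega>))} \<le> e"
proof -
  have \<xi>[measurable]: "\<xi> k \<in> borel_measurable M" for k
    using indep unfolding indep_vars_def2 by simp
  define c where "c i = expectation (\<lambda>\<omega>. (\<xi> 0 \<omega> $ i)\<^sup>2)" for i
  define C where "C = (\<Sum>i\<in>UNIV. c i)"
  have "0 \<le> C" unfolding C_def c_def by (intro sum_nonneg) simp
  define R where "R = sqrt (C / e) + 1"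
  have "R > 0" using \<open>0 \<le> C\<close> \<open>0 < e\<close> by (simp add: R_def add_nonneg_pos)
  have "C / e \<le> R\<^sup>2"
    using \<open>0 \<le> C\<close> \<open>0 < e\<close> by (simp add: R_def power2_sum)
  then have R2: "C / R\<^sup>2 \<le> e" using \<open>0 < e\<close> \<open>R > 0\<close> by (simp add: field_simps)
  have "prob {\<omega>\<in>space M. R < norm ((1 / sqrt n) *\<^sub>R (\<Sum>k<n. \<xi> k \<omega>))} \<le> e" for n
  proof -
    let ?Y = "\<lambda>\<omega>. (1 / sqrt n) *\<^sub>R (\<Sum>k<n. \<xi> k \<omega>)"
    have comp: "integrable M (\<lambda>\<omega>. (?Y \<omega> $ i)\<^sup>2) \<and> expectation (\<lambda>\<omega>. (?Y \<omega> $ i)\<^sup>2) \<le> c i" for i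
    proof -
      have p: "axis i 1 \<bullet> x = x $ i" for x :: "real^'d" by (simp add: inner_axis')
      note pr = iid_projection[of "axis i 1", unfolded p]
      have var: "expectation (\<lambda>\<omega>. (\<xi> k \<omega> $ i)\<^sup>2) = c i" for k
        using pr(4)[of k] by (simp add: c_def matrix_vector_mult_basis column_def power2_eq_square)
      have eq: "(?Y \<omega> $ i)\<^sup>2 = (1 / n) * (\<Sum>k<n. \<xi> k \<omega> $ i)\<^sup>2" for \<omega>
        by (simp add: power_mult_distrib power_divide)
      note * = expectation_square_sum_indep[OF pr(1,2,3) var, where n = n]
      show ?thesis unfolding eq using * by (auto simp: c_def)
    qed
    have norm2: "(norm (?Y \<omega>))\<^sup>2 = (\<Sum>i\<in>UNIV. (?Y \<omega> $ i)\<^sup>2)" for \<omega>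
      unfolding power2_norm_eq_inner inner_vec_def by (simp add: power2_eq_square)
    have int: "integrable M (\<lambda>\<omega>. (norm (?Y \<omega>))\<^sup>2)"
      unfolding norm2 using comp by (intro Bochner_Integration.integrable_sum) auto
    have le: "expectation (\<lambda>\<omega>. (norm (?Y \<omega>))\<^sup>2) \<le> C"
      unfolding norm2 C_def using comp
      by (subst Bochner_Integration.integral_sum) (auto intro: sum_mono)
    have "prob {\<omega>\<in>space M. R < norm (?Y \<omega>)} \<le> prob {\<omega>\<in>space M. R\<^sup>2 \<le> (norm (?Y \<omega>))\<^sup>2}"
      using \<open>R > 0\<close> by (intro finite_measure_mono) (auto intro!: power_mono)
    also have "\<dots> \<le> expectation (\<lambda>\<omega>. (norm (?Y \<omega>))\<^sup>2) / R\<^sup>2"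
      by (rule integral_Markov_inequality_measure[OF int, where A = "space M"]) (use \<open>R > 0\<close> in auto)
    also have "\<dots> \<le> C / R\<^sup>2" using le by (simp add: divide_right_mono)
    also have "\<dots> \<le> e" by (rule R2)
    finally show ?thesis .
  qed
  then show ?thesis using \<open>R > 0\<close> by blast
qed

end
end

section \<open>The delta method\<close>

lemma norm_iexp_diff_le: "cmod (iexp a - iexp b) \<le> \<bar>a - b\<bar>"
proof -
  have "iexp a - iexp b = iexp b * (iexp (a - b) - 1)"
    by (simp add: algebra_simps flip: exp_add)
  then have "cmod (iexp a - iexp b) = cmod (iexp (a - b) - 1)"
    by (simp add: norm_mult)
  also have "\<dots> \<le> \<bar>a - b\<bar>"
    using iexp_approx1[of "a - b" 0] by simp
  finally show ?thesis .
qed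

context prob_space
begin

text \<open>Slutsky's theorem: a perturbation that tends to zero in probability does not change the limit of
  the characteristic functions.\<close>

lemma slutsky_char:
  fixes T Z :: "nat \<Rightarrow> 'a \<Rightarrow> real^'d"
  assumes T: "\<forall>\<^sub>F n in sequentially. T n \<in> borel_measurable M"
    and Z: "\<And>n. Z n \<in> borel_measurable M"
    and diff: "\<And>e \<eta>. 0 < e \<Longrightarrow> 0 < \<eta> \<Longrightarrow>
      \<forall>\<^sub>F n in sequentially. prob {\<omega>\<in>space M. \<eta> < norm (T n \<omega> - Z n \<omega>)} \<le> e"
    and cf: "(\<lambda>n. \<integral>\<omega>. iexp (t \<bullet> Z n \<omega>) \<partial>M) \<longlonglongrightarrow> c"
  shows "(\<lambda>n. \<integral>\<omega>. iexp (t \<bullet> T n \<omega>) \<partial>M) \<longlonglongrightarrow> c"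
proof (rule Lim_transform[OF cf], rule tendstoI)
  note [measurable] = Z
  fix r :: real assume "0 < r"
  define \<eta> where "\<eta> = r / (4 * (norm t + 1))"
  have "\<eta> > 0" using \<open>0 < r\<close> by (simp add: \<eta>_def add_nonneg_pos)
  have \<eta>: "norm t * \<eta> \<le> r / 4"
  proof -
    have "norm t * \<eta> \<le> (norm t + 1) * \<eta>" using \<open>\<eta> > 0\<close> by simp
    also have "\<dots> = r / 4"
      using add_nonneg_pos[OF norm_ge_zero[of t] zero_less_one]
      by (simp add: \<eta>_def del: distrib_left_numeral)
    finally show ?thesis .
  qed
  have "\<forall>\<^sub>F n in sequentially. prob {\<omega>\<in>space M. \<eta> < norm (T n \<omega> - Z n \<omega>)} \<le> r / 8"
    using \<open>0 < r\<close> \<open>0 < \<eta>\<close> by (intro diff) auto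
  then show "\<forall>\<^sub>F n in sequentially. dist ((\<integral>\<omega>. iexp (t \<bullet> T n \<omega>) \<partial>M) - (\<integral>\<omega>. iexp (t \<bullet> Z n \<omega>) \<partial>M)) 0 < r"
    using T
  proof eventually_elim
    case (elim n)
    note [measurable] = elim(2)
    let ?E = "{\<omega>\<in>space M. \<eta> < norm (T n \<omega> - Z n \<omega>)}"
    have i: "integrable M (\<lambda>\<omega>. iexp (t \<bullet> Z n \<omega>))" "integrable M (\<lambda>\<omega>. iexp (t \<bullet> T n \<omega>))"
      by (auto intro!: integrable_const_bound[of _ 1])
    have "cmod ((\<integral>\<omega>. iexp (t \<bullet> Z n \<omega>) \<partial>M) - (\<integral>\<omega>. iexp (t \<bullet> T n \<omega>) \<partial>M))
        = cmod (\<integral>\<omega>. iexp (t \<bullet> Z n \<omega>) - iexp (t \<bullet> T n \<omega>) \<partial>M)"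
      using i by simp
    also have "\<dots> \<le> (\<integral>\<omega>. r / 4 + 2 * indicator ?E \<omega> \<partial>M)"
    proof (rule order_trans[OF integral_norm_bound integral_mono])
      show "integrable M (\<lambda>\<omega>. r / 4 + 2 * indicator ?E \<omega>)"
        by (intro Bochner_Integration.integrable_add integrable_mult_right)
          (auto simp: less_top[symmetric])
      show "cmod (iexp (t \<bullet> Z n \<omega>) - iexp (t \<bullet> T n \<omega>)) \<le> r / 4 + 2 * indicator ?E \<omega>"
        if "\<omega> \<in> space M" for \<omega>
      proof (cases "\<omega> \<in> ?E")
        case True
        have "cmod (iexp (t \<bullet> Z n \<omega>) - iexp (t \<bullet> T n \<omega>)) \<le> 1 + 1"
          by (rule order_trans[OF norm_triangle_ineq4]) simp
        then show ?thesis using True \<open>0 < r\<close> by simp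
      next
        case False
        have "cmod (iexp (t \<bullet> Z n \<omega>) - iexp (t \<bullet> T n \<omega>)) \<le> \<bar>t \<bullet> (Z n \<omega> - T n \<omega>)\<bar>"
          using norm_iexp_diff_le by (simp add: inner_diff_right)
        also have "\<dots> \<le> norm t * norm (Z n \<omega> - T n \<omega>)" by (rule Cauchy_Schwarz_ineq2)
        also have "\<dots> \<le> norm t * \<eta>"
          using False that by (intro mult_left_mono) (auto simp: norm_minus_commute)
        finally show ?thesis using \<eta> False by simp
      qed
    qed (use i in auto)
    also have "\<dots> = r / 4 + 2 * prob ?E"
      by (subst Bochner_Integration.integral_add)
        (auto simp: less_top[symmetric] prob_space intro!: integrable_mult_right)
    also have "\<dots> < r" using elim(1) \<open>0 < r\<close> by simp
    finally show ?case by (simp add: norm_minus_commute)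
  qed
qed

text \<open>The estimator needs to equal \<open>h\<close> of the statistic only where the statistic lies in a
  neighbourhood of its limit; elsewhere it is arbitrary, since that event has vanishing
  probability.\<close>

theorem delta_method:
  fixes s :: "nat \<Rightarrow> 'a \<Rightarrow> real^'d" and h :: "real^'d \<Rightarrow> real^'e" and Q :: "(real^'e) measure"
  assumes s: "\<And>n. s n \<in> borel_measurable M"
    and tight: "\<And>e. 0 < e \<Longrightarrow>
      \<exists>R>0. \<forall>\<^sub>F n in sequentially. prob {\<omega>\<in>space M. R < norm (sqrt n *\<^sub>R (s n \<omega> - s\<^sub>0))} \<le> e"
    and h: "(h has_derivative D) (at s\<^sub>0)" and U: "open U" "s\<^sub>0 \<in> U"
    and est: "\<forall>\<^sub>F n in sequentially. est n \<in> borel_measurable M"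
    and est_eq: "\<forall>\<^sub>F n in sequentially. \<forall>\<omega>\<in>space M. s n \<omega> \<in> U \<longrightarrow> est n \<omega> = h (s n \<omega>)"
    and Q: "prob_space Q" "sets Q = sets borel"
    and cf: "\<And>t. (\<lambda>n. \<integral>\<omega>. iexp (t \<bullet> D (sqrt n *\<^sub>R (s n \<omega> - s\<^sub>0))) \<partial>M) \<longlonglongrightarrow> (\<integral>x. iexp (t \<bullet> x) \<partial>Q)"
  shows "converges_in_dist M (\<lambda>n \<omega>. sqrt n *\<^sub>R (est n \<omega> - h s\<^sub>0)) Q"
proof -
  interpret D: bounded_linear D using h by (rule has_derivative_bounded_linear)
  note [measurable] = s
  define Y where "Y n \<omega> = sqrt n *\<^sub>R (s n \<omega> - s\<^sub>0)" for n :: nat and \<omega>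
  define T where "T n \<omega> = sqrt n *\<^sub>R (est n \<omega> - h s\<^sub>0)" for n :: nat and \<omega>
  have Y[measurable]: "Y n \<in> borel_measurable M" for n unfolding Y_def by measurable
  have [measurable]: "D \<in> borel_measurable borel"
    by (intro borel_measurable_continuous_onI D.continuous_on continuous_on_id)
  have Z[measurable]: "(\<lambda>\<omega>. D (Y n \<omega>)) \<in> borel_measurable M" for n by measurable
  have T: "\<forall>\<^sub>F n in sequentially. T n \<in> borel_measurable M"
    using est unfolding T_def
    by eventually_elim (intro borel_measurable_scaleR borel_measurable_diff borel_measurable_const)
  \<comment> \<open>On the event \<open>norm (Y n) \<le> R\<close> the statistic is within \<open>R / sqrt n\<close> of its limit, so for large \<open>n\<close>
    it lies in \<open>U\<close> and the linearization error of \<open>h\<close>, scaled by \<open>sqrt n\<close>, is at most \<open>\<eta>\<close>.\<close>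
  have close: "\<exists>R>0. \<forall>\<^sub>F n in sequentially. prob {\<omega>\<in>space M. R < norm (Y n \<omega>)} \<le> e \<and>
      (\<forall>\<omega>\<in>space M. norm (Y n \<omega>) \<le> R \<longrightarrow> norm (T n \<omega> - D (Y n \<omega>)) \<le> \<eta>)"
    if "0 < e" "0 < \<eta>" for e \<eta>
  proof -
    obtain R where R: "0 < R" "\<forall>\<^sub>F n in sequentially. prob {\<omega>\<in>space M. R < norm (Y n \<omega>)} \<le> e"
      using tight[OF \<open>0 < e\<close>] by (auto simp: Y_def)
    have "0 < \<eta> / R" using R \<open>0 < \<eta>\<close> by simp
    then obtain d1 where d1: "0 < d1"
      "\<And>y. norm (y - s\<^sub>0) < d1 \<Longrightarrow> norm (h y - h s\<^sub>0 - D (y - s\<^sub>0)) \<le> \<eta> / R * norm (y - s\<^sub>0)"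
      using h by (auto simp: has_derivative_at_alt)
    obtain d2 where d2: "0 < d2" "ball s\<^sub>0 d2 \<subseteq> U"
      using U by (auto simp: open_contains_ball)
    have "filterlim (\<lambda>n. sqrt (real n)) at_top sequentially"
      by (rule filterlim_compose[OF sqrt_at_top filterlim_real_sequentially])
    then have "\<forall>\<^sub>F n in sequentially. R / min d1 d2 < sqrt (real n)"
      by (simp add: filterlim_at_top_dense)
    then have "\<forall>\<^sub>F n in sequentially. prob {\<omega>\<in>space M. R < norm (Y n \<omega>)} \<le> e \<and>
      (\<forall>\<omega>\<in>space M. norm (Y n \<omega>) \<le> R \<longrightarrow> norm (T n \<omega> - D (Y n \<omega>)) \<le> \<eta>)"
      using R(2) est_eq
    proof eventually_elim
      case (elim n)
      have "0 < R / min d1 d2" using R(1) d1(1) d2(1) by simp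
      then have n: "0 < sqrt (real n)" using elim(1) by linarith
      have Rd: "R < min d1 d2 * sqrt n"
        using elim(1) d1(1) d2(1) by (simp add: divide_less_eq mult.commute)
      have "norm (T n \<omega> - D (Y n \<omega>)) \<le> \<eta>" if "\<omega> \<in> space M" "norm (Y n \<omega>) \<le> R" for \<omega>
      proof -
        have nY: "norm (Y n \<omega>) = sqrt n * norm (s n \<omega> - s\<^sub>0)"
          by (simp add: Y_def)
        have "norm (s n \<omega> - s\<^sub>0) * sqrt n < min d1 d2 * sqrt n"
          using Rd that(2) nY by (simp add: mult.commute)
        then have sd: "norm (s n \<omega> - s\<^sub>0) < min d1 d2"
          using n by (simp only: mult_less_cancel_right_pos)
        then have "s n \<omega> \<in> U"
          using d2(2) by (auto simp: dist_norm norm_minus_commute subset_iff)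
        then have "T n \<omega> - D (Y n \<omega>) = sqrt n *\<^sub>R (h (s n \<omega>) - h s\<^sub>0 - D (s n \<omega> - s\<^sub>0))"
          using elim(3) that(1) by (simp add: T_def Y_def D.scaleR scaleR_diff_right D.diff)
        then have "norm (T n \<omega> - D (Y n \<omega>)) = sqrt n * norm (h (s n \<omega>) - h s\<^sub>0 - D (s n \<omega> - s\<^sub>0))"
          by simp
        also have "\<dots> \<le> sqrt n * (\<eta> / R * norm (s n \<omega> - s\<^sub>0))"
          using d1(2)[of "s n \<omega>"] sd by (intro mult_left_mono) auto
        also have "\<dots> = \<eta> / R * norm (Y n \<omega>)" by (simp add: nY)
        also have "\<dots> \<le> \<eta> / R * R"
          using that(2) \<open>0 < \<eta> / R\<close> by (intro mult_left_mono) auto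
        finally show ?thesis using R(1) by simp
      qed
      then show ?case using elim(2) by blast
    qed
    then show ?thesis using R(1) by blast
  qed
  show ?thesis
    unfolding T_def[symmetric]
  proof (rule converges_in_dist_if_char_tendsto[OF prob_space_axioms Q T])
    show "(\<lambda>n. \<integral>\<omega>. iexp (t \<bullet> T n \<omega>) \<partial>M) \<longlonglongrightarrow> (\<integral>x. iexp (t \<bullet> x) \<partial>Q)" for t
    proof (rule slutsky_char[OF T Z _ cf[of t, folded Y_def]])
      fix e \<eta> :: real assume "0 < e" "0 < \<eta>"
      from close[OF this] obtain R where
        "\<forall>\<^sub>F n in sequentially. prob {\<omega>\<in>space M. R < norm (Y n \<omega>)} \<le> e \<and>
          (\<forall>\<omega>\<in>space M. norm (Y n \<omega>) \<le> R \<longrightarrow> norm (T n \<omega> - D (Y n \<omega>)) \<le> \<eta>)" by auto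
      then show "\<forall>\<^sub>F n in sequentially. prob {\<omega>\<in>space M. \<eta> < norm (T n \<omega> - D (Y n \<omega>))} \<le> e"
      proof eventually_elim
        case (elim n)
        have "prob {\<omega>\<in>space M. \<eta> < norm (T n \<omega> - D (Y n \<omega>))} \<le> prob {\<omega>\<in>space M. R < norm (Y n \<omega>)}"
          using elim by (intro finite_measure_mono) (auto simp: not_le[symmetric])
        then show ?case using elim by simp
      qed
    qed
  next
    fix e :: real assume "0 < e"
    from close[OF this zero_less_one] obtain R where R: "0 < R"
      "\<forall>\<^sub>F n in sequentially. prob {\<omega>\<in>space M. R < norm (Y n \<omega>)} \<le> e \<and>
        (\<forall>\<omega>\<in>space M. norm (Y n \<omega>) \<le> R \<longrightarrow> norm (T n \<omega> - D (Y n \<omega>)) \<le> 1)" by auto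
    obtain K where K: "0 < K" "\<And>x. norm (D x) \<le> norm x * K" using D.pos_bounded by blast
    have "\<forall>\<^sub>F n in sequentially. prob {\<omega>\<in>space M. R * K + 1 < norm (T n \<omega>)} \<le> e"
      using R(2)
    proof eventually_elim
      case (elim n)
      have "norm (T n \<omega>) \<le> R * K + 1" if "\<omega> \<in> space M" "norm (Y n \<omega>) \<le> R" for \<omega>
      proof -
        have "norm (D (Y n \<omega>)) \<le> R * K"
          using K(2)[of "Y n \<omega>"] that(2) K(1) by (meson less_imp_le mult_right_mono order_trans)
        moreover have "norm (T n \<omega> - D (Y n \<omega>)) \<le> 1" using elim that by blast
        ultimately show ?thesis
          using norm_triangle_sub[of "T n \<omega>" "D (Y n \<omega>)"] by linarith
      qed
      then have "prob {\<omega>\<in>space M. R * K + 1 < norm (T n \<omega>)} \<le> prob {\<omega>\<in>space M. R < norm (Y n \<omega>)}"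
        by (intro finite_measure_mono) (auto simp: not_le[symmetric])
      then show ?case using elim by simp
    qed
    moreover have "0 < R * K + 1" using R(1) K(1) by (simp add: add_pos_pos)
    ultimately show "\<exists>R>0. \<forall>\<^sub>F n in sequentially. prob {\<omega>\<in>space M. R < norm (T n \<omega>)} \<le> e"
      by blast
  qed
qed

end

section \<open>Gradients and conjugates on the space of symmetric matrices\<close>

lemma subspace_sym_mats: "subspace (sym_mats :: (real^'m^'m) set)"
  by (auto simp: subspace_def sym_mats_def transpose_def vec_eq_iff)

lemma tr_inner_eq_inner: "B \<in> sym_mats \<Longrightarrow> tr_inner A B = A \<bullet> B"
  by (simp add: tr_inner_def trace_def matrix_matrix_mult_def inner_vec_def sym_mats_def
      transpose_def vec_eq_iff)

lemma tr_inner_eq_inner': "A \<in> sym_mats \<Longrightarrow> tr_inner A B = A \<bullet> B"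
  using tr_inner_eq_inner[of A B] trace_mul_sym[of A B] by (simp add: tr_inner_def inner_commute)

lemma pd_mats_sym: "A \<in> pd_mats \<Longrightarrow> A \<in> sym_mats"
  by (simp add: pd_mats_def)

lemma norm_outer_sq: "norm (outer_sq x) = (norm x)\<^sup>2"
proof -
  have "outer_sq x \<bullet> outer_sq x = (x \<bullet> x)\<^sup>2"
    by (simp add: inner_vec_def outer_sq_def power2_eq_square sum_product algebra_simps)
  then show ?thesis by (simp add: norm_eq_sqrt_inner)
qed

lemma openin_pd_mats: "openin (top_of_set sym_mats) (pd_mats :: (real^'m^'m) set)"
proof -
  have "\<exists>d>0. \<forall>B\<in>sym_mats. dist B A < d \<longrightarrow> B \<in> pd_mats" if A: "A \<in> pd_mats" for A :: "real^'m^'m"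
  proof -
    have pos: "0 < x \<bullet> (A *v x)" if "x \<noteq> 0" for x
      using A that by (simp add: pd_mats_def)
    have "continuous_on (sphere 0 1) (\<lambda>x. x \<bullet> (A *v x))"
      by (intro continuous_intros)
    moreover have "sphere (0::real^'m) 1 \<noteq> {}" by simp
    ultimately obtain x0 where x0: "norm x0 = 1" "\<And>x. norm x = 1 \<Longrightarrow> x0 \<bullet> (A *v x0) \<le> x \<bullet> (A *v x)"
      using continuous_attains_inf[OF compact_sphere, of 0 1 "\<lambda>x. x \<bullet> (A *v x)"] by auto
    define c where "c = x0 \<bullet> (A *v x0)"
    have "c > 0" unfolding c_def using x0(1) by (intro pos) auto
    have mv: "\<bar>x \<bullet> (H *v x)\<bar> \<le> norm H * (norm x)\<^sup>2" for H :: "real^'m^'m" and x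
    proof -
      have "x \<bullet> (H *v x) = H \<bullet> outer_sq x"
        by (simp add: inner_vec_def matrix_vector_mult_def outer_sq_def sum_distrib_left algebra_simps)
      then show ?thesis using Cauchy_Schwarz_ineq2[of H "outer_sq x"] by (simp add: norm_outer_sq)
    qed
    have "B \<in> pd_mats" if B: "B \<in> sym_mats" "dist B A < c" for B
    proof -
      have "0 < x \<bullet> (B *v x)" if "x \<noteq> 0" for x
      proof -
        have *: "c * (norm x)\<^sup>2 \<le> x \<bullet> (A *v x)"
        proof -
          have "c \<le> (x /\<^sub>R norm x) \<bullet> (A *v (x /\<^sub>R norm x))"
            using that unfolding c_def by (intro x0(2)) simp
          also have "\<dots> = x \<bullet> (A *v x) / (norm x)\<^sup>2"
            by (simp add: matrix_vector_mult_scaleR power2_eq_square field_simps)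
          finally show ?thesis using that by (simp add: field_simps)
        qed
        have "\<bar>x \<bullet> ((B - A) *v x)\<bar> \<le> norm (B - A) * (norm x)\<^sup>2" by (rule mv)
        also have "\<dots> < c * (norm x)\<^sup>2"
          using B(2) that by (simp add: dist_norm)
        finally have "\<bar>x \<bullet> (B *v x) - x \<bullet> (A *v x)\<bar> < c * (norm x)\<^sup>2"
          by (simp add: matrix_vector_mult_diff_rdistrib inner_diff_right)
        with * show ?thesis by linarith
      qed
      then show ?thesis using B(1) by (simp add: pd_mats_def)
    qed
    then show ?thesis using \<open>c > 0\<close> by blast
  qed
  moreover have "(pd_mats :: (real^'m^'m) set) \<subseteq> sym_mats" by (auto simp: pd_mats_def)
  ultimately show ?thesis unfolding openin_euclidean_subtopology_iff by blast
qed

text \<open>A continuous selection of subgradients is a gradient.  No convexity of \<open>S\<close> is needed, which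
  matters because the set of gradients \<^const>\<open>L_plus\<close> need not be convex.\<close>

lemma has_derivative_if_continuous_subgradient:
  fixes f :: "'b::real_inner \<Rightarrow> real"
  assumes "x \<in> S"
    and sub: "\<And>y z. y \<in> S \<Longrightarrow> z \<in> S \<Longrightarrow> f y + g y \<bullet> (z - y) \<le> f z"
    and cont: "continuous (at x within S) g"
  shows "(f has_derivative (\<lambda>h. g x \<bullet> h)) (at x within S)"
  unfolding has_derivative_within_alt
proof (intro conjI allI impI)
  show "bounded_linear (\<lambda>h. g x \<bullet> h)" by (rule bounded_linear_inner_right)
  fix e :: real assume "0 < e"
  then obtain d where d: "0 < d" "\<And>y. y \<in> S \<Longrightarrow> dist y x < d \<Longrightarrow> dist (g y) (g x) < e"
    using cont by (auto simp: continuous_within_eps_delta)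
  have "norm (f y - f x - g x \<bullet> (y - x)) \<le> e * norm (y - x)" if y: "y \<in> S" "norm (y - x) < d" for y
  proof -
    have "0 \<le> f y - f x - g x \<bullet> (y - x)" using sub[OF \<open>x \<in> S\<close> y(1)] by simp
    moreover have "f y - f x - g x \<bullet> (y - x) \<le> (g y - g x) \<bullet> (y - x)"
      using sub[OF y(1) \<open>x \<in> S\<close>] by (simp add: inner_diff_left inner_diff_right)
    moreover have "(g y - g x) \<bullet> (y - x) \<le> norm (g y - g x) * norm (y - x)"
      by (rule norm_cauchy_schwarz)
    moreover have "norm (g y - g x) * norm (y - x) \<le> e * norm (y - x)"
      using d(2)[OF y(1)] y(2) by (intro mult_right_mono) (auto simp: dist_norm)
    ultimately show ?thesis by simp
  qed
  then show "\<exists>d>0. \<forall>y\<in>S. norm (y - x) < d \<longrightarrow> norm (f y - f x - g x \<bullet> (y - x)) \<le> e * norm (y - x)"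
    using d(1) by blast
qed

text \<open>A fixed function of the class \<open>\<E>\<^sup>m\<close>.\<close>

locale bregman =
  fixes F :: "real^'m^'m \<Rightarrow> ereal"
  assumes F: "F \<in> bregman_class"
begin

lemma not_MInf: "A \<in> sym_mats \<Longrightarrow> F A \<noteq> -\<infinity>"
  using F by (simp add: bregman_class_def)

lemma finite_on_pd: "A \<in> pd_mats \<Longrightarrow> \<bar>F A\<bar> \<noteq> \<infinity>"
  using F not_MInf by (fastforce simp: bregman_class_def dom_sym_def pd_mats_def)

lemma has_grad: "A \<in> pd_mats \<Longrightarrow> has_grad_sym F (grad_sym F A) A"
proof -
  assume A: "A \<in> pd_mats"
  then obtain G where "has_grad_sym F G A"
    using F by (auto simp: bregman_class_def cont_diff_on_pd_def)
  then have "\<exists>!G. has_grad_sym F G A"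
    using has_grad_sym_unique[OF pd_mats_sym[OF A]] by blast
  then show ?thesis unfolding grad_sym_def by (rule theI')
qed

lemma grad_in_sym: "A \<in> pd_mats \<Longrightarrow> grad_sym F A \<in> sym_mats"
  using has_grad by (simp add: has_grad_sym_def)

lemma subgradient:
  assumes A: "A \<in> pd_mats" and B: "B \<in> sym_mats"
  shows "F A + ereal (grad_sym F A \<bullet> (B - A)) \<le> F B"
proof (cases "F B = \<infinity>")
  case False
  obtain b where b: "F B = ereal b" using False not_MInf[OF B] by (cases "F B") auto
  obtain a where a: "F A = ereal a" using finite_on_pd[OF A] by (cases "F A") auto
  let ?f = "\<lambda>X. real_of_ereal (F X)"
  define \<gamma> where "\<gamma> u = A + u *\<^sub>R (B - A)" for u :: real
  have sub: "\<gamma> ` UNIV \<subseteq> sym_mats"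
    using subspace_sym_mats pd_mats_sym[OF A] B
    by (auto simp: \<gamma>_def intro: subspace_add subspace_scale subspace_diff)
  have "(\<gamma> has_derivative (\<lambda>u. u *\<^sub>R (B - A))) (at 0)"
    unfolding \<gamma>_def by (auto intro!: derivative_eq_intros)
  moreover have "(?f has_derivative (\<lambda>H. tr_inner (grad_sym F A) H)) (at (\<gamma> 0) within \<gamma> ` UNIV)"
    using has_grad[OF A] by (intro has_derivative_subset[OF _ sub]) (simp add: has_grad_sym_def \<gamma>_def)
  ultimately have "((?f \<circ> \<gamma>) has_derivative ((\<lambda>H. tr_inner (grad_sym F A) H) \<circ> (\<lambda>u. u *\<^sub>R (B - A)))) (at 0)"
    by (rule diff_chain_within)
  moreover have "tr_inner (grad_sym F A) (u *\<^sub>R (B - A)) = u * (grad_sym F A \<bullet> (B - A))" for u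
    using tr_inner_eq_inner'[OF grad_in_sym[OF A], of "u *\<^sub>R (B - A)"] by simp
  ultimately have "((?f \<circ> \<gamma>) has_real_derivative (grad_sym F A \<bullet> (B - A))) (at 0)"
    by (simp add: has_field_derivative_def o_def mult_commute_abs)
  then have "((\<lambda>u. (?f (\<gamma> u) - ?f A) / u) \<longlongrightarrow> grad_sym F A \<bullet> (B - A)) (at_right 0)"
    by (auto simp: DERIV_def \<gamma>_def intro: filterlim_mono[OF _ order_refl at_le])
  moreover have "\<forall>\<^sub>F u in at_right 0. (?f (\<gamma> u) - ?f A) / u \<le> b - a"
  proof -
    have "(?f (\<gamma> u) - ?f A) / u \<le> b - a" if u: "0 < u" "u < 1" for u
    proof -
      have eq: "\<gamma> u = (1 - u) *\<^sub>R A + u *\<^sub>R B" by (simp add: \<gamma>_def algebra_simps)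
      have "F (\<gamma> u) \<le> ereal (1 - u) * F A + ereal u * F B"
        unfolding eq using F u B pd_mats_sym[OF A] by (auto simp: bregman_class_def convex_sym_def)
      moreover have "F (\<gamma> u) \<noteq> -\<infinity>" using not_MInf sub by blast
      ultimately have "?f (\<gamma> u) \<le> (1 - u) * a + u * b" by (cases "F (\<gamma> u)") (auto simp: a b)
      then show ?thesis using u by (simp add: a field_simps)
    qed
    then show ?thesis unfolding eventually_at_right_field by (intro exI[of _ 1]) auto
  qed
  ultimately have "grad_sym F A \<bullet> (B - A) \<le> b - a"
    by (intro tendsto_upperbound[OF _ _ trivial_limit_at_right_real])
  then show ?thesis by (simp add: a b)
qed simp

lemma subgradient_strict:
  assumes A: "A \<in> pd_mats" and B: "B \<in> pd_mats" and "A \<noteq> B"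
  shows "F A + ereal (grad_sym F A \<bullet> (B - A)) < F B"
proof -
  obtain b where b: "F B = ereal b" using finite_on_pd[OF B] by (cases "F B") auto
  obtain a where a: "F A = ereal a" using finite_on_pd[OF A] by (cases "F A") auto
  define C where "C = (1 - 1/2) *\<^sub>R A + (1/2) *\<^sub>R B"
  have "C \<in> sym_mats"
    unfolding C_def using subspace_sym_mats pd_mats_sym[OF A] pd_mats_sym[OF B]
    by (intro subspace_add subspace_scale)
  have CA: "C - A = (1/2) *\<^sub>R (B - A)" by (simp add: C_def vec_eq_iff field_simps)
  have "F A + ereal (grad_sym F A \<bullet> (C - A)) \<le> F C" by (rule subgradient[OF A \<open>C \<in> sym_mats\<close>])
  also have "F C < ereal (1 - 1/2) * F A + ereal (1/2) * F B"
  proof -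
    have "strictly_convex_on_pd F" using F by (simp add: bregman_class_def)
    then show ?thesis
      unfolding C_def strictly_convex_on_pd_def using assms by (elim ballE allE[of _ "1/2"]) auto
  qed
  finally have "a + (grad_sym F A \<bullet> (B - A)) / 2 < (1 - 1/2) * a + 1/2 * b"
    by (simp only: a b CA inner_scaleR_right) simp
  then show ?thesis by (simp add: a b)
qed

lemma grad_strict_mono:
  assumes A: "A \<in> pd_mats" and B: "B \<in> pd_mats" and "A \<noteq> B"
  shows "0 < (grad_sym F B - grad_sym F A) \<bullet> (B - A)"
proof -
  obtain b where b: "F B = ereal b" using finite_on_pd[OF B] by (cases "F B") auto
  obtain a where a: "F A = ereal a" using finite_on_pd[OF A] by (cases "F A") auto
  have "a + grad_sym F A \<bullet> (B - A) < b" "b + grad_sym F B \<bullet> (A - B) < a"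
    using subgradient_strict[OF A B] subgradient_strict[OF B A] assms(3) by (auto simp: a b)
  then show ?thesis by (simp add: inner_diff_left inner_diff_right)
qed

text \<open>Strict monotonicity makes the gradient injective, so invariance of domain in the space of
  symmetric matrices shows that its range is open and its inverse continuous.\<close>

lemma grad_homeomorphism:
  obtains \<sigma> where "openin (top_of_set sym_mats) (L_plus F)"
    "homeomorphism pd_mats (L_plus F) (grad_sym F) \<sigma>"
proof -
  have inj: "inj_on (grad_sym F) pd_mats"
    using grad_strict_mono by (fastforce simp: inj_on_def)
  have cont: "continuous_on pd_mats (grad_sym F)"
    using F by (simp add: bregman_class_def cont_diff_on_pd_def)
  have openin: "openin (top_of_set sym_mats) (grad_sym F ` U)"
    if "openin (top_of_set sym_mats) U" "U \<subseteq> pd_mats" for U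
    by (rule invariance_of_domain_subspaces[OF that(1) subspace_sym_mats subspace_sym_mats])
      (use that grad_in_sym inj_on_subset[OF inj] continuous_on_subset[OF cont] in auto)
  have L: "openin (top_of_set sym_mats) (L_plus F)"
    unfolding L_plus_def by (rule openin[OF openin_pd_mats order_refl])
  obtain \<sigma> where "homeomorphism pd_mats (L_plus F) (grad_sym F) \<sigma>"
  proof (rule homeomorphism_injective_open_map[OF cont _ inj])
    show "grad_sym F ` pd_mats = L_plus F" by (simp add: L_plus_def)
    show "openin (top_of_set (L_plus F)) (grad_sym F ` U)" if "openin (top_of_set pd_mats) U" for U
    proof -
      have "openin (top_of_set sym_mats) U" "U \<subseteq> pd_mats"
        using openin_trans[OF that openin_pd_mats] openin_imp_subset[OF that] by auto
      then have "openin (top_of_set sym_mats) (grad_sym F ` U)" by (rule openin)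
      then show ?thesis
        using \<open>U \<subseteq> pd_mats\<close> openin_imp_subset[OF L]
        by (auto intro: openin_subset_trans simp: L_plus_def)
    qed
  qed
  with L show ?thesis using that by blast
qed

text \<open>Equality in the Fenchel--Young inequality.\<close>

lemma conj_sym_grad:
  assumes A: "A \<in> pd_mats"
  shows "conj_sym F (grad_sym F A) = ereal (A \<bullet> grad_sym F A) - F A"
  unfolding conj_sym_def
proof (rule antisym)
  have tr: "tr_inner B (grad_sym F A) = B \<bullet> grad_sym F A" for B
    by (rule tr_inner_eq_inner[OF grad_in_sym[OF A]])
  obtain a where a: "F A = ereal a" using finite_on_pd[OF A] by (cases "F A") auto
  show "(SUP B\<in>sym_mats. ereal (tr_inner B (grad_sym F A)) - F B) \<le> ereal (A \<bullet> grad_sym F A) - F A"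
  proof (rule SUP_least)
    fix B :: "real^'m^'m" assume B: "B \<in> sym_mats"
    show "ereal (tr_inner B (grad_sym F A)) - F B \<le> ereal (A \<bullet> grad_sym F A) - F A"
      using subgradient[OF A B] not_MInf[OF B]
      by (cases "F B") (auto simp: a tr inner_diff_right inner_commute)
  qed
  show "ereal (A \<bullet> grad_sym F A) - F A \<le> (SUP B\<in>sym_mats. ereal (tr_inner B (grad_sym F A)) - F B)"
    by (rule SUP_upper2[OF pd_mats_sym[OF A]]) (simp add: tr)
qed

lemma conj_sym_subgradient:
  assumes A: "A \<in> pd_mats" and B: "B \<in> pd_mats"
  shows "real_of_ereal (conj_sym F (grad_sym F A)) + A \<bullet> (grad_sym F B - grad_sym F A)
    \<le> real_of_ereal (conj_sym F (grad_sym F B))"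
proof -
  obtain b where b: "F B = ereal b" using finite_on_pd[OF B] by (cases "F B") auto
  obtain a where a: "F A = ereal a" using finite_on_pd[OF A] by (cases "F A") auto
  have "b + grad_sym F B \<bullet> (A - B) \<le> a"
    using subgradient[OF B pd_mats_sym[OF A]] by (simp add: a b)
  then show ?thesis
    by (simp add: conj_sym_grad A B a b inner_diff_right inner_commute)
qed

text \<open>The inverse of the gradient is a continuous selection of subgradients of the conjugate, hence
  its gradient.\<close>

lemma has_grad_sym_conj:
  assumes A: "A \<in> pd_mats"
  shows "has_grad_sym (conj_sym F) A (grad_sym F A)"
proof -
  obtain \<sigma> where L: "openin (top_of_set sym_mats) (L_plus F)"
    and hom: "homeomorphism pd_mats (L_plus F) (grad_sym F) \<sigma>"
    by (rule grad_homeomorphism)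
  let ?g = "\<lambda>L. real_of_ereal (conj_sym F L)"
  have \<sigma>: "\<sigma> (grad_sym F B) = B" if "B \<in> pd_mats" for B
    using hom that by (simp add: homeomorphism_def)
  have "grad_sym F A \<in> L_plus F" using A by (simp add: L_plus_def)
  have "(?g has_derivative (\<lambda>H. \<sigma> (grad_sym F A) \<bullet> H)) (at (grad_sym F A) within L_plus F)"
  proof (rule has_derivative_if_continuous_subgradient)
    show "grad_sym F A \<in> L_plus F" by fact
    show "?g Y + \<sigma> Y \<bullet> (Z - Y) \<le> ?g Z" if "Y \<in> L_plus F" "Z \<in> L_plus F" for Y Z
      using that conj_sym_subgradient \<sigma> by (auto simp: L_plus_def)
    show "continuous (at (grad_sym F A) within L_plus F) \<sigma>"
      using hom \<open>grad_sym F A \<in> L_plus F\<close> by (auto simp: homeomorphism_def continuous_on_eq_continuous_within)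
  qed
  then have "(?g has_derivative (\<lambda>H. A \<bullet> H)) (at (grad_sym F A) within L_plus F)"
    by (simp add: \<sigma> A)
  moreover have "at (grad_sym F A) within L_plus F = at (grad_sym F A) within sym_mats"
  proof -
    obtain T where "open T" "L_plus F = sym_mats \<inter> T" using L by (auto simp: openin_open)
    then show ?thesis
      using \<open>grad_sym F A \<in> L_plus F\<close> by (intro at_within_nhd[of _ T]) auto
  qed
  moreover have "tr_inner A H = A \<bullet> H" for H
    by (rule tr_inner_eq_inner'[OF pd_mats_sym[OF A]])
  ultimately show ?thesis using A pd_mats_sym by (simp add: has_grad_sym_def)
qed

lemma grad_sym_conj:
  assumes A: "A \<in> pd_mats"
  shows "grad_sym (conj_sym F) (grad_sym F A) = A"
  unfolding grad_sym_def[of "conj_sym F"]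
  using has_grad_sym_conj[OF A] has_grad_sym_unique[OF grad_in_sym[OF A]] by blast

end

section \<open>The M-estimating equation\<close>

lemma pd_matrix_inv:
  fixes M :: "real^'d^'d"
  assumes "M \<in> pd_mats"
  shows "matrix_inv M ** M = mat 1" and "transpose (matrix_inv M) = matrix_inv M"
proof -
  have "x = 0" if "M *v x = 0" for x
    using assms that by (auto simp: pd_mats_def)
  then have "invertible M"
    by (simp add: invertible_left_inverse matrix_left_invertible_ker)
  then have inv: "M ** matrix_inv M = mat 1 \<and> matrix_inv M ** M = mat 1"
    unfolding invertible_def matrix_inv_def by (rule someI_ex)
  then show left: "matrix_inv M ** M = mat 1" by simp
  have "transpose M = M" using assms by (simp add: pd_mats_def sym_mats_def)
  then have "transpose (matrix_inv M) ** M = mat 1"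
    using inv by (metis matrix_transpose_mul transpose_mat)
  then show "transpose (matrix_inv M) = matrix_inv M"
    using inv by (metis matrix_mul_assoc matrix_mul_lid matrix_mul_rid)
qed

text \<open>The inner products of a matrix with the matrices \<open>A i\<close>.  The objective depends on the sample
  covariance matrix only through this vector.\<close>

definition coords :: "('d::finite \<Rightarrow> real^'m^'m) \<Rightarrow> real^'m^'m \<Rightarrow> real^'d" where
  "coords A S = (\<chi> i. A i \<bullet> S)"

lemma linear_coords: "linear (coords A)"
  by (rule linearI) (simp_all add: coords_def vec_eq_iff inner_add_right)

lemma lin_par_inner: "lin_par A \<theta> \<bullet> S = \<theta> \<bullet> coords A S"
  by (simp add: lin_par_def coords_def inner_sum_left inner_vec_def[of \<theta>])

lemma linear_lin_par: "linear (lin_par A)"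
  by (rule linearI) (simp_all add: lin_par_def scaleR_add_left sum.distrib scaleR_sum_right)

lemma continuous_coords: "continuous_on UNIV (coords A)"
  using linear_coords by (auto intro: linear_continuous_on simp: linear_conv_bounded_linear)

lemma continuous_lin_par: "continuous_on UNIV (lin_par A)"
  using linear_lin_par by (auto intro: linear_continuous_on simp: linear_conv_bounded_linear)

text \<open>The function together with an orthonormal family of symmetric matrices; \<^term>\<open>tr_inner\<close> is
  replaced by the inner product of matrices, with which it agrees on symmetric matrices.\<close>

locale bregman_model = bregman F for F :: "real^'m^'m \<Rightarrow> ereal" +
  fixes A :: "'d::finite \<Rightarrow> real^'m^'m"
  assumes A_sym: "A i \<in> sym_mats"
    and orthonormal: "A i \<bullet> A j = (if i = j then 1 else 0)"
begin

lemma lin_par_sym: "lin_par A \<theta> \<in> sym_mats"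
  unfolding lin_par_def
  by (intro subspace_sum[OF subspace_sym_mats] subspace_scale[OF subspace_sym_mats] A_sym)

lemma coords_lin_par: "coords A (lin_par A \<theta>) = \<theta>"
  by (simp add: coords_def lin_par_def vec_eq_iff inner_sum_right orthonormal if_distrib cong: if_cong)

text \<open>The coordinates of the covariance matrix that belongs to the parameter \<open>\<theta>\<close>, which is also the
  gradient of \<open>\<theta> \<mapsto> F\<^sup>* (L \<theta>)\<close>.  It is meaningful on \<^term>\<open>Theta_plus F A\<close> only.\<close>

definition mean_map :: "real^'d \<Rightarrow> real^'d" where
  "mean_map \<theta> = coords A (inv_into pd_mats (grad_sym F) (lin_par A \<theta>))"

lemma Theta_plus_cases:
  assumes "\<theta> \<in> Theta_plus F A"
  obtains B where "B \<in> pd_mats" "lin_par A \<theta> = grad_sym F B" "mean_map \<theta> = coords A B"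
proof -
  obtain B where B: "B \<in> pd_mats" "lin_par A \<theta> = grad_sym F B"
    using assms by (auto simp: Theta_plus_def L_plus_def)
  have "inj_on (grad_sym F) pd_mats"
    using grad_strict_mono by (fastforce simp: inj_on_def)
  then have "mean_map \<theta> = coords A B"
    using B by (simp add: mean_map_def)
  with B show thesis by (rule that)
qed

lemma open_Theta_plus: "open (Theta_plus F A)"
proof -
  obtain \<sigma> where "openin (top_of_set sym_mats) (L_plus F)"
    "homeomorphism pd_mats (L_plus F) (grad_sym F) \<sigma>"
    by (rule grad_homeomorphism)
  then obtain T where T: "open T" "L_plus F = sym_mats \<inter> T" by (auto simp: openin_open)
  have "Theta_plus F A = lin_par A -` T"
    using lin_par_sym by (auto simp: Theta_plus_def T)
  then show ?thesis
    using open_vimage[OF T(1) continuous_lin_par] by simp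
qed

lemma continuous_mean_map: "continuous_on (Theta_plus F A) mean_map"
proof -
  obtain \<sigma> where hom: "homeomorphism pd_mats (L_plus F) (grad_sym F) \<sigma>"
    by (rule grad_homeomorphism)
  have "continuous_on (L_plus F) \<sigma>" using hom by (simp add: homeomorphism_def)
  moreover have "lin_par A ` Theta_plus F A \<subseteq> L_plus F" by (auto simp: Theta_plus_def)
  ultimately have "continuous_on (Theta_plus F A) (\<lambda>\<theta>. \<sigma> (lin_par A \<theta>))"
    by (rule continuous_on_compose2[OF _ continuous_on_subset[OF continuous_lin_par subset_UNIV]])
  then have "continuous_on (Theta_plus F A) (\<lambda>\<theta>. coords A (\<sigma> (lin_par A \<theta>)))"
    by (rule continuous_on_compose2[OF continuous_coords]) simp
  moreover have "coords A (\<sigma> (lin_par A \<theta>)) = mean_map \<theta>" if "\<theta> \<in> Theta_plus F A" for \<theta>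
    using Theta_plus_cases[OF that] hom by (metis homeomorphism_apply1)
  ultimately show ?thesis by (simp cong: continuous_on_cong)
qed

lemma mean_map_strict_mono:
  assumes "\<theta> \<in> Theta_plus F A" "\<theta>' \<in> Theta_plus F A" "\<theta> \<noteq> \<theta>'"
  shows "0 < (mean_map \<theta>' - mean_map \<theta>) \<bullet> (\<theta>' - \<theta>)"
proof -
  obtain B where B: "B \<in> pd_mats" "lin_par A \<theta> = grad_sym F B" "mean_map \<theta> = coords A B"
    using assms(1) by (rule Theta_plus_cases)
  obtain B' where B': "B' \<in> pd_mats" "lin_par A \<theta>' = grad_sym F B'" "mean_map \<theta>' = coords A B'"
    using assms(2) by (rule Theta_plus_cases)
  have "B \<noteq> B'" using assms(3) B(2) B'(2) coords_lin_par by metis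
  then have "0 < (grad_sym F B' - grad_sym F B) \<bullet> (B' - B)"
    by (rule grad_strict_mono[OF B(1) B'(1)])
  also have "grad_sym F B' - grad_sym F B = lin_par A (\<theta>' - \<theta>)"
    by (simp add: B B' linear_diff[OF linear_lin_par])
  also have "\<dots> \<bullet> (B' - B) = (mean_map \<theta>' - mean_map \<theta>) \<bullet> (\<theta>' - \<theta>)"
    by (simp only: lin_par_inner) (simp add: linear_diff[OF linear_coords] B B' inner_commute)
  finally show ?thesis .
qed

lemma inj_mean_map: "inj_on mean_map (Theta_plus F A)"
  using mean_map_strict_mono by (fastforce simp: inj_on_def)

lemma bregman_obj_eq:
  "bregman_obj F A S \<theta> = real_of_ereal (conj_sym F (lin_par A \<theta>)) - \<theta> \<bullet> coords A S"
  by (simp add: bregman_obj_def tr_inner_eq_inner'[OF lin_par_sym] lin_par_inner)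

lemma bregman_obj_subgradient:
  assumes "\<theta> \<in> Theta_plus F A" "\<theta>' \<in> Theta_plus F A"
  shows "bregman_obj F A S \<theta> + (mean_map \<theta> - coords A S) \<bullet> (\<theta>' - \<theta>) \<le> bregman_obj F A S \<theta>'"
proof -
  obtain B where B: "B \<in> pd_mats" "lin_par A \<theta> = grad_sym F B" "mean_map \<theta> = coords A B"
    using assms(1) by (rule Theta_plus_cases)
  obtain B' where B': "B' \<in> pd_mats" "lin_par A \<theta>' = grad_sym F B'" "mean_map \<theta>' = coords A B'"
    using assms(2) by (rule Theta_plus_cases)
  have "B \<bullet> (grad_sym F B' - grad_sym F B) = (\<theta>' - \<theta>) \<bullet> coords A B"
    by (simp add: B(2)[symmetric] B'(2)[symmetric] linear_diff[OF linear_lin_par, symmetric]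
        lin_par_inner inner_commute[of B])
  then show ?thesis
    using conj_sym_subgradient[OF B(1) B'(1)]
    by (simp add: bregman_obj_eq B B' inner_commute inner_diff_right inner_diff_left)
qed

lemma bregman_obj_has_derivative:
  assumes "\<theta> \<in> Theta_plus F A"
  shows "(bregman_obj F A S has_derivative (\<lambda>h. (mean_map \<theta> - coords A S) \<bullet> h)) (at \<theta>)"
proof -
  have "(bregman_obj F A S has_derivative (\<lambda>h. (mean_map \<theta> - coords A S) \<bullet> h)) (at \<theta> within Theta_plus F A)"
  proof (rule has_derivative_if_continuous_subgradient[OF assms])
    show "continuous (at \<theta> within Theta_plus F A) (\<lambda>\<theta>. mean_map \<theta> - coords A S)"
      using continuous_mean_map assms
      by (intro continuous_intros) (simp add: continuous_on_eq_continuous_within)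
  qed (rule bregman_obj_subgradient)
  then show ?thesis by (simp add: at_within_open[OF assms open_Theta_plus])
qed

text \<open>Minimality is the estimating equation: the gradient vanishes at a minimizer because the
  parameter set is open, and a stationary point is a minimizer because the gradient is a global
  subgradient.\<close>

lemma is_bregman_min_iff:
  "is_bregman_min F A S \<theta> \<longleftrightarrow> \<theta> \<in> Theta_plus F A \<and> mean_map \<theta> = coords A S"
proof (intro iffI conjI)
  assume min: "is_bregman_min F A S \<theta>"
  then show \<theta>: "\<theta> \<in> Theta_plus F A" by (simp add: is_bregman_min_def is_arg_min_def)
  have "(\<lambda>h. (mean_map \<theta> - coords A S) \<bullet> h) = (\<lambda>h. 0)"
  proof (rule differential_zero_maxmin[OF \<theta> open_Theta_plus bregman_obj_has_derivative[OF \<theta>]])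
    show "(\<forall>y\<in>Theta_plus F A. bregman_obj F A S y \<le> bregman_obj F A S \<theta>) \<or>
      (\<forall>y\<in>Theta_plus F A. bregman_obj F A S \<theta> \<le> bregman_obj F A S y)"
      using min by (auto simp: is_bregman_min_def is_arg_min_def not_less)
  qed
  then show "mean_map \<theta> = coords A S"
    by (metis inner_eq_zero_iff right_minus_eq)
next
  assume *: "\<theta> \<in> Theta_plus F A \<and> mean_map \<theta> = coords A S"
  then show "is_bregman_min F A S \<theta>"
    using bregman_obj_subgradient[of \<theta> _ S]
    by (auto simp: is_bregman_min_def is_arg_min_def not_less)
qed

lemma mean_map_has_derivative:
  assumes "\<theta> \<in> Theta_plus F A" "has_hessian (bregman_obj F A S) H \<theta>"
  shows "(mean_map has_derivative (\<lambda>h. H *v h)) (at \<theta>)"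
proof -
  obtain g where g: "\<forall>\<^sub>F y in nhds \<theta>. (bregman_obj F A S has_derivative (\<lambda>h. g y \<bullet> h)) (at y)"
    "(g has_derivative (\<lambda>h. H *v h)) (at \<theta>)"
    using assms(2) by (auto simp: has_hessian_def)
  have "\<forall>\<^sub>F y in nhds \<theta>. y \<in> Theta_plus F A"
    using open_Theta_plus assms(1) by (rule eventually_nhds_in_open)
  then have ev: "\<forall>\<^sub>F y in nhds \<theta>. g y + coords A S = mean_map y"
    using g(1)
  proof eventually_elim
    case (elim y)
    have "(\<lambda>h. (mean_map y - coords A S) \<bullet> h) = (\<lambda>h. g y \<bullet> h)"
      by (rule has_derivative_unique[OF bregman_obj_has_derivative[OF elim(1)] elim(2)])
    then have "(mean_map y - coords A S - g y) \<bullet> h = 0" for h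
      by (metis inner_diff_left right_minus_eq)
    then show ?case by (metis inner_eq_zero_iff diff_add_cancel right_minus_eq)
  qed
  have "((\<lambda>y. g y + coords A S) has_derivative (\<lambda>h. H *v h)) (at \<theta>)"
    using has_derivative_add_const[OF g(2)] .
  then show ?thesis
    by (rule has_derivative_transform_eventually)
      (use ev eventually_nhds_x_imp_x[OF ev] in \<open>auto simp: eventually_at_filter elim: eventually_mono\<close>)
qed

end

lemma continuous_outer_sq: "continuous_on UNIV outer_sq"
  unfolding outer_sq_def by (intro continuous_intros)

text \<open>The moments needed for the central limit theorem: the square of a quadratic form in \<open>X\<close> is
  dominated by the fourth power of the norm of \<open>X\<close>.\<close>

lemma (in prob_space) quadratic_score_moments:
  fixes X :: "'a \<Rightarrow> real^'m" and B :: "real^'m^'m"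
  assumes X: "X \<in> borel_measurable M" and mean: "(\<integral>\<omega>. X \<omega> \<partial>M) = 0"
    and m4: "integrable M (\<lambda>\<omega>. norm (X \<omega>) ^ 4)"
  shows "integrable M (\<lambda>\<omega>. (B \<bullet> (outer_sq (X \<omega>) - cov_matrix M X))\<^sup>2)"
    and "expectation (\<lambda>\<omega>. B \<bullet> (outer_sq (X \<omega>) - cov_matrix M X)) = 0"
proof -
  note [measurable] = X borel_measurable_continuous_onI[OF continuous_outer_sq]
  let ?\<Sigma> = "cov_matrix M X"
  have m2: "integrable M (\<lambda>\<omega>. (norm (X \<omega>))\<^sup>2)"
    by (rule square_integrable_imp_integrable) (use m4 in \<open>simp_all flip: power_mult\<close>)
  have "integrable M (\<lambda>\<omega>. norm (X \<omega>))"
    by (rule square_integrable_imp_integrable[OF _ m2]) simp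
  then have m1: "integrable M X" by (simp add: integrable_norm_iff)
  have comp: "(\<integral>\<omega>. X \<omega> $ i \<partial>M) = 0" for i
    using integral_bounded_linear[OF bounded_linear_vec_nth[of i] m1] mean by simp
  have mO: "integrable M (\<lambda>\<omega>. outer_sq (X \<omega>))"
    by (rule Bochner_Integration.integrable_bound[OF m2]) (auto simp: norm_outer_sq)
  have EO: "(\<integral>\<omega>. outer_sq (X \<omega>) \<partial>M) = ?\<Sigma>"
  proof -
    have "(\<integral>\<omega>. outer_sq (X \<omega>) \<partial>M) $ i $ j = (\<integral>\<omega>. X \<omega> $ i * X \<omega> $ j \<partial>M)" for i j
      using integral_bounded_linear[OF bounded_linear_compose[OF bounded_linear_vec_nth[of j] bounded_linear_vec_nth[of i]] mO]
      by (simp add: outer_sq_def)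
    then show ?thesis by (simp add: cov_matrix_def comp vec_eq_iff)
  qed
  show "expectation (\<lambda>\<omega>. B \<bullet> (outer_sq (X \<omega>) - ?\<Sigma>)) = 0"
    using mO EO by (simp add: prob_space)
  show "integrable M (\<lambda>\<omega>. (B \<bullet> (outer_sq (X \<omega>) - ?\<Sigma>))\<^sup>2)"
  proof (rule Bochner_Integration.integrable_bound)
    show "integrable M (\<lambda>\<omega>. 2 * (norm B)\<^sup>2 * (norm (X \<omega>) ^ 4 + (norm ?\<Sigma>)\<^sup>2))"
      using m4 by simp
    have "(B \<bullet> (outer_sq x - ?\<Sigma>))\<^sup>2 \<le> 2 * (norm B)\<^sup>2 * (norm x ^ 4 + (norm ?\<Sigma>)\<^sup>2)" for x
    proof -
      have "\<bar>B \<bullet> (outer_sq x - ?\<Sigma>)\<bar> \<le> norm B * norm (outer_sq x - ?\<Sigma>)"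
        by (rule Cauchy_Schwarz_ineq2)
      also have "\<dots> \<le> norm B * ((norm x)\<^sup>2 + norm ?\<Sigma>)"
        using norm_triangle_ineq4[of "outer_sq x" ?\<Sigma>] by (intro mult_left_mono) (auto simp: norm_outer_sq)
      finally have "(B \<bullet> (outer_sq x - ?\<Sigma>))\<^sup>2 \<le> (norm B * ((norm x)\<^sup>2 + norm ?\<Sigma>))\<^sup>2"
        by (metis abs_ge_zero power2_abs power_mono)
      also have "\<dots> \<le> (norm B)\<^sup>2 * (2 * (((norm x)\<^sup>2)\<^sup>2 + (norm ?\<Sigma>)\<^sup>2))"
        unfolding power_mult_distrib
        by (intro mult_left_mono) (use sum_squares_bound[of "(norm x)\<^sup>2" "norm ?\<Sigma>"] in \<open>auto simp: power2_sum\<close>)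
      finally show ?thesis by (simp add: algebra_simps flip: power_mult)
    qed
    then show "AE \<omega> in M. norm ((B \<bullet> (outer_sq (X \<omega>) - ?\<Sigma>))\<^sup>2)
        \<le> norm (2 * (norm B)\<^sup>2 * (norm (X \<omega>) ^ 4 + (norm ?\<Sigma>)\<^sup>2))"
      by (intro AE_I2) (simp add: abs_of_nonneg)
  qed measurable
qed

section \<open>Asymptotic normality\<close>

theorem theorem4p3:
  fixes P :: "'a measure"
    and F :: "real^'m^'m \<Rightarrow> ereal"
    and V :: "(real^'m^'m) set"
    and A :: "'d::finite \<Rightarrow> real^'m^'m"
    and X :: "nat \<Rightarrow> 'a \<Rightarrow> real^'m"
    and \<Sigma>\<^sub>0 :: "real^'m^'m"
    and \<theta>\<^sub>0 :: "real^'d"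
    and \<I> :: "real^'d \<Rightarrow> real^'d^'d"
    and est :: "nat \<Rightarrow> 'a \<Rightarrow> real^'d"
  assumes "F \<in> bregman_class"
    and "subspace V" and "V \<subseteq> sym_mats" and "orthonormal_basis_of A V"
    and "prob_space P"
    and "iid_seq P X"
    and "(\<integral>\<omega>. X 0 \<omega> \<partial>P) = 0"
    and "integrable P (\<lambda>\<omega>. norm (X 0 \<omega>) ^ 4)"
    and "\<Sigma>\<^sub>0 = cov_matrix P (X 0)" and "\<Sigma>\<^sub>0 \<in> pd_mats"
    and "\<theta>\<^sub>0 \<in> Theta_plus F A" and "\<Sigma>\<^sub>0 = grad_sym (conj_sym F) (lin_par A \<theta>\<^sub>0)"
    and "\<And>\<theta>. \<theta> \<in> Theta_plus F A \<Longrightarrow>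
           has_hessian (bregman_obj F A \<Sigma>\<^sub>0) (\<I> \<theta>) \<theta> \<and> \<I> \<theta> \<in> pd_mats"
    and "is_bregman_estimator P F A X est"
  shows "converges_in_dist P (\<lambda>n \<omega>. sqrt (real n) *\<^sub>R (est n \<omega> - \<theta>\<^sub>0))
           (mvn 0 (matrix_inv (\<I> \<theta>\<^sub>0)
                     ** (\<chi> i j. fourth_moment_form P (X 0) \<Sigma>\<^sub>0 (A i) (A j))
                     ** matrix_inv (\<I> \<theta>\<^sub>0)))"
proof -
  interpret prob_space P by fact
  have A_sym: "A i \<in> sym_mats" for i
    using assms(3,4) span_base[of "A i" "range A"] by (auto simp: orthonormal_basis_of_def)
  interpret bregman_model F A
    by unfold_locales (use assms(1,4) A_sym in \<open>auto simp: orthonormal_basis_of_def tr_inner_eq_inner[symmetric]\<close>)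
  have indepX: "indep_vars (\<lambda>_. borel) X UNIV" and distX: "distr P borel (X k) = distr P borel (X 0)" for k
    using assms(6) by (auto simp: iid_seq_def)
  have [measurable]: "X k \<in> borel_measurable P" for k
    using indepX unfolding indep_vars_def2 by simp
  note [measurable] = borel_measurable_continuous_onI[OF continuous_outer_sq]
  note [measurable] = borel_measurable_continuous_onI[OF continuous_coords]

  define \<xi> where "\<xi> k \<omega> = coords A (outer_sq (X k \<omega>) - \<Sigma>\<^sub>0)" for k \<omega>
  define s where "s n \<omega> = coords A (sample_cov X n \<omega>)" for n \<omega>
  define s\<^sub>0 where "s\<^sub>0 = coords A \<Sigma>\<^sub>0"
  define J where "J = matrix_inv (\<I> \<theta>\<^sub>0)"
  define \<Omega> where "\<Omega> = (\<chi> i j. fourth_moment_form P (X 0) \<Sigma>\<^sub>0 (A i) (A j))"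

  have \<xi>_indep: "indep_vars (\<lambda>_. borel) \<xi> UNIV"
    unfolding \<xi>_def by (rule indep_vars_compose2[OF indepX]) measurable
  have \<xi>_dist: "distr P borel (\<xi> k) = distr P borel (\<xi> 0)" for k
  proof -
    have "distr P borel (\<xi> k) = distr (distr P borel (X k)) borel (\<lambda>x. coords A (outer_sq x - \<Sigma>\<^sub>0))" for k
      unfolding \<xi>_def by (subst distr_distr) (auto simp: o_def)
    then show ?thesis by (simp add: distX[of k])
  qed
  have \<xi>_mean: "expectation (\<lambda>\<omega>. \<xi> 0 \<omega> $ i) = 0"
    and \<xi>_int2: "integrable P (\<lambda>\<omega>. (\<xi> 0 \<omega> $ i)\<^sup>2)" for i
    using quadratic_score_moments[of "X 0" "A i"] assms(7,8) by (simp_all add: \<xi>_def coords_def assms(9))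
  have \<Omega>: "\<Omega> = (\<chi> i j. expectation (\<lambda>\<omega>. \<xi> 0 \<omega> $ i * \<xi> 0 \<omega> $ j))"
    unfolding \<Omega>_def fourth_moment_form_def \<xi>_def coords_def
    using A_sym by (simp add: tr_inner_eq_inner inner_commute)
  have sum_\<xi>: "sqrt n *\<^sub>R (s n \<omega> - s\<^sub>0) = (1 / sqrt n) *\<^sub>R (\<Sum>k<n. \<xi> k \<omega>)" for n \<omega>
  proof (cases "n = 0")
    case False
    have "(\<Sum>k<n. \<xi> k \<omega>) = real n *\<^sub>R (s n \<omega> - s\<^sub>0)"
      using False
      by (simp add: \<xi>_def s_def s\<^sub>0_def sample_cov_def linear_diff[OF linear_coords] linear_sum[OF linear_coords]
          linear_cmul[OF linear_coords] sum_subtractf scaleR_diff_right sum_constant_scaleR del: sum_constant)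
    then show ?thesis using False by (simp add: real_div_sqrt)
  qed simp

  have J: "J ** \<I> \<theta>\<^sub>0 = mat 1" "transpose J = J"
    unfolding J_def using pd_matrix_inv assms(11,13) by blast+
  have J_inner: "t \<bullet> (J *v y) = (J *v t) \<bullet> y" for t y
    by (metis J(2) dot_lmul_matrix transpose_matrix_vector)
  have quad: "t \<bullet> ((J ** \<Omega> ** J) *v t) = (J *v t) \<bullet> (\<Omega> *v (J *v t))" for t
    by (simp add: J_inner flip: matrix_vector_mul_assoc)
  have "0 \<le> t \<bullet> (\<Omega> *v t)" for t
    unfolding \<Omega> iid_projection(4)[OF \<xi>_indep \<xi>_dist \<xi>_mean \<xi>_int2, of t 0, symmetric] by simp
  moreover have "transpose \<Omega> = \<Omega>"
    by (simp add: \<Omega> transpose_def vec_eq_iff mult.commute)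
  ultimately have psd: "J ** \<Omega> ** J \<in> psd_mats"
    by (simp add: psd_mats_def sym_mats_def quad matrix_transpose_mul J(2) matrix_mul_assoc)

  \<comment> \<open>the estimator as a function of the coordinates of the sample covariance matrix\<close>
  obtain h where h: "homeomorphism (Theta_plus F A) (mean_map ` Theta_plus F A) mean_map h"
    by (rule invariance_of_domain_homeomorphism[OF open_Theta_plus continuous_mean_map _ inj_mean_map]) simp
  define U where "U = mean_map ` Theta_plus F A"
  have U: "open U"
    unfolding U_def by (rule invariance_of_domain[OF continuous_mean_map open_Theta_plus inj_mean_map])
  have hU: "continuous_on U h" "\<And>y. y \<in> U \<Longrightarrow> h y \<in> Theta_plus F A" "\<And>y. y \<in> U \<Longrightarrow> mean_map (h y) = y"
    "\<And>\<theta>. \<theta> \<in> Theta_plus F A \<Longrightarrow> h (mean_map \<theta>) = \<theta>"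
    using h by (auto simp: homeomorphism_def U_def)
  have mean_\<theta>\<^sub>0: "mean_map \<theta>\<^sub>0 = s\<^sub>0"
  proof -
    obtain B where "B \<in> pd_mats" "lin_par A \<theta>\<^sub>0 = grad_sym F B" "mean_map \<theta>\<^sub>0 = coords A B"
      using assms(11) by (rule Theta_plus_cases)
    then show ?thesis using assms(12) grad_sym_conj by (simp add: s\<^sub>0_def)
  qed
  have s\<^sub>0U: "s\<^sub>0 \<in> U" and hs\<^sub>0: "h s\<^sub>0 = \<theta>\<^sub>0"
    using mean_\<theta>\<^sub>0 assms(11) hU(4) by (auto simp: U_def)
  have h': "(h has_derivative (\<lambda>y. J *v y)) (at s\<^sub>0)"
  proof (rule has_derivative_inverse_basic[where T = U])
    show "(mean_map has_derivative (\<lambda>v. \<I> \<theta>\<^sub>0 *v v)) (at (h s\<^sub>0))"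
      unfolding hs\<^sub>0 using assms(11,13) by (blast intro: mean_map_has_derivative)
    show "bounded_linear (\<lambda>y. J *v y)" by (rule matrix_vector_mul_bounded_linear)
    show "(\<lambda>y. J *v y) \<circ> (\<lambda>v. \<I> \<theta>\<^sub>0 *v v) = id"
      by (simp add: fun_eq_iff matrix_vector_mul_assoc J)
    show "continuous (at s\<^sub>0) h"
      using hU(1) U s\<^sub>0U continuous_on_eq_continuous_at by blast
  qed (use U s\<^sub>0U hU(3) in auto)

  have min_iff: "(\<exists>\<theta>. is_bregman_min F A (sample_cov X n \<omega>) \<theta>) \<longleftrightarrow> s n \<omega> \<in> U" for n \<omega>
    unfolding is_bregman_min_iff s_def U_def image_iff by metis
  \<comment> \<open>\<open>n = 0\<close> is excluded: no condition is imposed on the estimator from an empty sample\<close>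
  have est: "\<exists>c\<in>borel_measurable P. \<forall>\<omega>\<in>space P. est n \<omega> = (if s n \<omega> \<in> U then h (s n \<omega>) else c \<omega>)"
    if "1 \<le> n" for n
  proof -
    obtain c where c: "c \<in> borel_measurable P"
      "\<And>\<omega>. \<omega> \<in> space P \<Longrightarrow> if \<exists>\<theta>. is_bregman_min F A (sample_cov X n \<omega>) \<theta>
        then is_bregman_min F A (sample_cov X n \<omega>) (est n \<omega>) else est n \<omega> = c \<omega>"
      using assms(14) \<open>1 \<le> n\<close> unfolding is_bregman_estimator_def by (elim allE[of _ n] impE bexE) auto
    have "est n \<omega> = (if s n \<omega> \<in> U then h (s n \<omega>) else c \<omega>)" if "\<omega> \<in> space P" for \<omega>
    proof (cases "s n \<omega> \<in> U")
      case True
      then have "is_bregman_min F A (sample_cov X n \<omega>) (est n \<omega>)"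
        using c(2)[OF that] min_iff by simp
      then have "est n \<omega> \<in> Theta_plus F A" "mean_map (est n \<omega>) = s n \<omega>"
        unfolding is_bregman_min_iff s_def by auto
      then show ?thesis using hU(4) True by force
    qed (use c(2)[OF that] min_iff in auto)
    then show ?thesis using c(1) by blast
  qed
  have s_meas[measurable]: "s n \<in> borel_measurable P" for n
    unfolding s_def sample_cov_def by measurable
  have est_meas: "est n \<in> borel_measurable P" if "1 \<le> n" for n
  proof -
    obtain c where c[measurable]: "c \<in> borel_measurable P"
      and e: "\<And>\<omega>. \<omega> \<in> space P \<Longrightarrow> est n \<omega> = (if s n \<omega> \<in> U then h (s n \<omega>) else c \<omega>)"
      using est[OF \<open>1 \<le> n\<close>] by blast
    have [measurable]: "U \<in> sets borel" using U by simp
    have "(\<lambda>y. if y \<in> U then h y else 0) \<in> borel_measurable borel"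
      by (rule borel_measurable_continuous_on_if[OF _ hU(1)]) auto
    note [measurable] = this
    have "(\<lambda>\<omega>. if s n \<omega> \<in> U then (\<lambda>y. if y \<in> U then h y else 0) (s n \<omega>) else c \<omega>) \<in> borel_measurable P"
      by measurable
    then show ?thesis by (rule measurable_cong[THEN iffD1, rotated]) (simp add: e)
  qed

  have "converges_in_dist P (\<lambda>n \<omega>. sqrt (real n) *\<^sub>R (est n \<omega> - h s\<^sub>0)) (mvn 0 (J ** \<Omega> ** J))"
  proof (rule delta_method[OF s_meas _ h' U s\<^sub>0U _ _ prob_space_mvn sets_mvn])
    show "\<exists>R>0. \<forall>\<^sub>F n in sequentially. prob {\<omega>\<in>space P. R < norm (sqrt n *\<^sub>R (s n \<omega> - s\<^sub>0))} \<le> e"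
      if "0 < e" for e
      unfolding sum_\<xi>
      using iid_sum_tight[OF \<xi>_indep \<xi>_dist \<xi>_mean \<xi>_int2 that] by (meson always_eventually)
    show "\<forall>\<^sub>F n in sequentially. est n \<in> borel_measurable P"
      using est_meas by (auto simp: eventually_sequentially)
    show "\<forall>\<^sub>F n in sequentially. \<forall>\<omega>\<in>space P. s n \<omega> \<in> U \<longrightarrow> est n \<omega> = h (s n \<omega>)"
      using eventually_ge_at_top[of 1] by eventually_elim (use est in fastforce)
    show "(\<lambda>n. \<integral>\<omega>. iexp (t \<bullet> (J *v (sqrt n *\<^sub>R (s n \<omega> - s\<^sub>0)))) \<partial>P)
        \<longlonglongrightarrow> (\<integral>x. iexp (t \<bullet> x) \<partial>mvn 0 (J ** \<Omega> ** J))" for t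
      using clt_char_vec[OF \<xi>_indep \<xi>_dist \<xi>_mean \<xi>_int2, of "J *v t"]
      unfolding sum_\<xi> J_inner char_mvn[OF psd] quad \<Omega>[symmetric] .
  qed
  then show ?thesis unfolding hs\<^sub>0 J_def \<Omega>_def .
qed

end
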